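(* The self-similar solution $\psi_0(t,r)=f_0\left(\frac{r}{1-t}\right)$, $f_0(\rho)=-\frac{8\rho^2}{5+3\rho^2}$, of the Yang-Mills equation $$\psi_{tt}-\psi_{rr}-\frac{2}{r}\psi_r+\frac{3\psi(\psi+1)(\psi+2)}{r^2}=0$$ is mode stable. That is: if $\lambda\in\mathbb{C}$ satisfies $\operatorname{Re}\lambda\ge 0$ and $u\in C^\infty[0,1]$ is a nonzero (complex-valued) solution on $(0,1)$ of $$-(1-\rho^2)\left(u''(\rho)+\tfrac{2}{\rho}u'(\rho)\right)+2\lambda\rho\, u'(\rho)+\lambda(\lambda+1)u(\rho)+\frac{V(\rho)}{\rho^2}u(\rho)=0,$$ with $$V(\rho)=6+18f_0(\rho)+9f_0(\rho)^2=6\,\frac{25-90\rho^2+33\rho^4}{(5+3\rho^2)^2},$$ then $\lambda=1$ and $u$ is a scalar multiple of $u_1(\rho):=-\rho f_0'(\rho)=\frac{80\rho^2}{(5+3\rho^2)^2}$.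
   Context: In similarity coordinates $\tau=-\log(1-t)$, $\rho=\frac{r}{1-t}$, with $\phi(\tau,\rho)=\psi(1-e^{-\tau},e^{-\tau}\rho)$, the Yang-Mills equation becomes $$\phi_{\tau\tau}+\phi_\tau+2\rho\phi_{\tau\rho}-(1-\rho^2)\left(\phi_{\rho\rho}+\tfrac{2}{\rho}\phi_\rho\right)+\frac{3\phi(\phi+1)(\phi+2)}{\rho^2}=0.$$ Inserting the mode ansatz $\phi(\tau,\rho)=f_0(\rho)+e^{\lambda\tau}u_\lambda(\rho)$, $\lambda\in\mathbb{C}$, and linearizing in $u_\lambda$ gives the ODE spectral problem displayed in the claim. A nonzero solution $u_\lambda\in C^\infty[0,1]$ of this ODE with $\operatorname{Re}\lambda\ge 0$ is called an unstable mode, and the corresponding $\lambda$ is called an unstable eigenvalue. The function $u_1$ is an unstable mode with $\lambda=1$, arising from time translation symmetry. The solution $\psi_0$ (or $f_0$) is called mode stable if $u_1$ is the only unstable mode. *)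

theory Defs
  imports "HOL-Analysis.Analysis"
begin

text \<open>Classical solutions of the Yang-Mills equation on \<open>{(t, r). t < 1, r > 0}\<close>. The
  existentially quantified functions are the partial derivatives of \<open>\<psi>\<close>.\<close>

definition yang_mills_solution :: "(real \<Rightarrow> real \<Rightarrow> real) \<Rightarrow> bool" where
  "yang_mills_solution \<psi> \<longleftrightarrow>
     (\<exists>\<psi>t \<psi>tt \<psi>r \<psi>rr. \<forall>t<1. \<forall>r>0.
        ((\<lambda>s. \<psi> s r) has_real_derivative \<psi>t t r) (at t) \<and>
        ((\<lambda>s. \<psi>t s r) has_real_derivative \<psi>tt t r) (at t) \<and>
        ((\<lambda>s. \<psi> t s) has_real_derivative \<psi>r t r) (at r) \<and>
        ((\<lambda>s. \<psi>r t s) has_real_derivative \<psi>rr t r) (at r) \<and>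
        \<psi>tt t r - \<psi>rr t r - 2 / r * \<psi>r t r
          + 3 * \<psi> t r * (\<psi> t r + 1) * (\<psi> t r + 2) / r\<^sup>2 = 0)"

definition self_similar :: "(real \<Rightarrow> real) \<Rightarrow> real \<Rightarrow> real \<Rightarrow> real" where
  "self_similar f t r = f (r / (1 - t))"

definition f0 :: "real \<Rightarrow> real" where
  "f0 \<rho> = - (8 * \<rho>\<^sup>2 / (5 + 3 * \<rho>\<^sup>2))"

text \<open>The derivative of the nonlinearity \<open>3\<phi>(\<phi> + 1)(\<phi> + 2)\<close> at \<open>\<phi> = f(\<rho>)\<close>.\<close>

definition potential :: "(real \<Rightarrow> real) \<Rightarrow> real \<Rightarrow> real" where
  "potential f \<rho> = 6 + 18 * f \<rho> + 9 * (f \<rho>)\<^sup>2"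

text \<open>\<open>C\<^sup>\<infinity>(S)\<close> for functions of one real variable: \<open>D n\<close> is the \<open>n\<close>-th derivative,
  one-sided at the end points when \<open>S\<close> is a compact interval. Values of \<open>u\<close> outside \<open>S\<close>
  are irrelevant.\<close>

definition C_infinity_on :: "real set \<Rightarrow> (real \<Rightarrow> 'a::real_normed_vector) \<Rightarrow> bool" where
  "C_infinity_on S u \<longleftrightarrow>
     (\<exists>D :: nat \<Rightarrow> real \<Rightarrow> 'a. (\<forall>x\<in>S. D 0 x = u x) \<and>
        (\<forall>n. \<forall>x\<in>S. (D n has_vector_derivative D (Suc n) x) (at x within S)))"

definition mode_equation :: "(real \<Rightarrow> real) \<Rightarrow> complex \<Rightarrow> (real \<Rightarrow> complex) \<Rightarrow> real \<Rightarrow> bool" where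
  "mode_equation f lam u \<rho> \<longleftrightarrow>
     (let u' = (\<lambda>x. vector_derivative u (at x));
          u'' = (\<lambda>x. vector_derivative u' (at x))
      in - complex_of_real (1 - \<rho>\<^sup>2) * (u'' \<rho> + complex_of_real (2 / \<rho>) * u' \<rho>)
         + 2 * lam * complex_of_real \<rho> * u' \<rho> + lam * (lam + 1) * u \<rho>
         + complex_of_real (potential f \<rho> / \<rho>\<^sup>2) * u \<rho> = 0)"

definition unstable_mode :: "(real \<Rightarrow> real) \<Rightarrow> complex \<Rightarrow> (real \<Rightarrow> complex) \<Rightarrow> bool" where
  "unstable_mode f lam u \<longleftrightarrow>
     Re lam \<ge> 0 \<and> C_infinity_on {0..1} u \<and> (\<exists>\<rho>\<in>{0..1}. u \<rho> \<noteq> 0) \<and>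
     (\<forall>\<rho>\<in>{0<..<1}. mode_equation f lam u \<rho>)"

text \<open>The mode arising from time translation symmetry, written \<open>u\<^sub>1\<close> when \<open>f\<close> is \<open>f0\<close>.\<close>

definition translation_mode :: "(real \<Rightarrow> real) \<Rightarrow> real \<Rightarrow> real" where
  "translation_mode f \<rho> = - \<rho> * deriv f \<rho>"

text \<open>Solutions of the linear mode equation are only determined up to a (complex) constant
  factor, so uniqueness of the unstable mode is understood up to such a factor.\<close>

definition mode_stable :: "(real \<Rightarrow> real) \<Rightarrow> bool" where
  "mode_stable f \<longleftrightarrow>
     unstable_mode f 1 (\<lambda>\<rho>. complex_of_real (translation_mode f \<rho>)) \<and>
     (\<forall>lam u. unstable_mode f lam u \<longrightarrow>
        lam = 1 \<and> (\<exists>c. \<forall>\<rho>\<in>{0..1}. u \<rho> = c * complex_of_real (translation_mode f \<rho>)))"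

end

theory Submission
  imports Defs
begin

text \<open>
  The profile equation for \<open>f0\<close>, the formulas for the potential and for \<open>u\<^sub>1\<close>, and the fact
  that \<open>u\<^sub>1\<close> solves the mode equation with \<open>\<lambda> = 1\<close> are verified by computation. The content is
  the converse: no other smooth solution exists for \<open>Re \<lambda> \<ge> 0\<close>.

  Removing the translation mode. Let \<open>\<nu> = \<lambda> - 1\<close>, \<open>x = artanh \<rho>\<close> and
  \<open>h = (1 - \<rho>\<^sup>2)\<^bsup>\<nu>/2\<^esup> \<rho> u\<close>. The mode equation becomes \<open>h\<^sub>x\<^sub>x = (U + \<nu>\<^sup>2) h\<close>, and \<open>u\<^sub>1\<close> becomes
  the positive solution \<open>h\<^sub>0\<close> for \<open>\<nu> = 0\<close>, so \<open>U = W\<^sup>2 + W\<^sub>x\<close> with \<open>W\<close> the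
  logarithmic derivative of \<open>h\<^sub>0\<close>. The Darboux transformation \<open>h \<mapsto> h\<^sub>x - W h\<close> annihilates \<open>h\<^sub>0\<close>
  and leads to the partner \<open>W\<^sup>2 - W\<^sub>x = (1 - \<rho>\<^sup>2) Q\<close>. While the potential of the mode equation is
  negative near the light cone \<open>\<rho> = 1\<close>, \<open>Q\<close> is positive, with \<open>Q > 1/4\<close>, and
  \<open>(1 + \<rho>)\<^sup>2 Q\<close> is decreasing. Without the weight \<open>(1 - \<rho>\<^sup>2)\<^bsup>\<nu>/2\<^esup>\<close> the transformed function is
    \<open>y = (1 - \<rho>\<^sup>2) (\<rho> u' + k u) - \<nu> \<rho>\<^sup>2 u\<close>, where \<open>k = - \<rho> u\<^sub>1' / u\<^sub>1\<close>,
  which is smooth up to both end points and vanishes at \<open>0\<close>, since the equation forces \<open>u(0) = 0\<close>.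
  It satisfies \<open>- (1 - \<rho>\<^sup>2) y'' + 2 \<lambda> \<rho> y' + \<lambda> (\<lambda> - 1) y + Q y = 0\<close>
  (\<open>darboux_half_wave_system\<close>).

  No modes remain. With \<open>P = \<nu> y + (1 + \<rho>) y'\<close>, which is the outgoing null derivative of the wave
  \<open>(1 - t)\<^bsup>-\<nu>\<^esup> y(r / (1 - t))\<close> up to a power of \<open>1 - t\<close>, the equation for \<open>y\<close> splits into
    \<open>(1 + \<rho>) y' = P - \<nu> y\<close> and \<open>(1 - \<rho>) P' = \<lambda> P + Q y\<close>,
  and smoothness at \<open>\<rho> = 1\<close> leaves its trace as \<open>\<lambda> P(1) + Q(1) y(1) = 0\<close>.
  Write \<open>\<lambda> = \<sigma> + i \<omega>\<close>. If \<open>\<omega> \<noteq> 0\<close>, put \<open>m = 1 / ((1 + \<rho>)\<^sup>2 Q)\<close> and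
    \<open>H = \<omega>\<^sup>2 m |P|\<^sup>2 + \<omega> Im (cnj P y) / (1 + \<rho>)\<close>.
  All mixed terms cancel in
    \<open>(1 - \<rho>\<^sup>2) H' - 2 \<sigma> \<rho> H = \<omega>\<^sup>2 ((1 - \<rho>\<^sup>2) m' + 2 \<sigma> m) |P|\<^sup>2 \<ge> 0\<close>,
  so \<open>(1 - \<rho>\<^sup>2)\<^bsup>\<sigma>\<^esup> H\<close> is nondecreasing. It starts at \<open>0\<close>, and the condition at \<open>\<rho> = 1\<close> gives
  \<open>H(1) \<le> 0\<close>; hence the right hand side vanishes identically, and so do \<open>P\<close> and \<open>y\<close>
  (\<open>nonreal_half_wave_rigidity\<close>). If \<open>\<lambda>\<close> is real, the same reasoning applies to
  \<open>H = Re (y' cnj y)\<close>, for which the right hand side is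
  \<open>(1 - \<rho>\<^sup>2) |y'|\<^sup>2 + (\<lambda> (\<lambda> - 1) + Q) |y|\<^sup>2\<close>, and \<open>\<lambda> (\<lambda> - 1) \<ge> - 1/4 > - Q\<close>
  (\<open>real_half_wave_rigidity\<close>).

  Conclusion. Since \<open>y = 0\<close>, the function \<open>h\<close> is a multiple of \<open>h\<^sub>0\<close>, which solves the
  equation for \<open>h\<close> only if \<open>\<nu> = 0\<close>. So \<open>\<lambda> = 1\<close> and \<open>u\<close> is a multiple of \<open>u\<^sub>1\<close>.
\<close>

section \<open>The self-similar solution\<close>

lemma denominator_pos: "5 + 3 * (x::real)\<^sup>2 > 0"
  by (simp add: add_pos_nonneg)

lemma potential_f0:
  "potential f0 x = 6 * ((25 - 90 * x\<^sup>2 + 33 * x ^ 4) / (5 + 3 * x\<^sup>2)\<^sup>2)"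
proof -
  have "5 + 3 * x\<^sup>2 > 0" by (simp add: add_pos_nonneg)
  then show ?thesis
    by (simp add: potential_def f0_def divide_simps power2_eq_square power4_eq_xxxx)
      (simp add: algebra_simps)
qed

definition f0' :: "real \<Rightarrow> real" where
  "f0' x = - (80 * x / (5 + 3 * x\<^sup>2)\<^sup>2)"

definition f0'' :: "real \<Rightarrow> real" where
  "f0'' x = 80 * (9 * x\<^sup>2 - 5) / (5 + 3 * x\<^sup>2) ^ 3"

lemma f0_derivatives:
  "(f0 has_real_derivative f0' x) (at x)"
  "(f0' has_real_derivative f0'' x) (at x)"
proof -
  have pos: "5 + 3 * x\<^sup>2 > 0" by (simp add: add_pos_nonneg)
  then have "5 + 3 * x\<^sup>2 \<noteq> 0" by simp
  then show "(f0 has_real_derivative f0' x) (at x)"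
    unfolding f0_def[abs_def] f0'_def
    by (auto intro!: derivative_eq_intros simp: divide_simps power2_eq_square)
      (simp add: algebra_simps)
  show "(f0' has_real_derivative f0'' x) (at x)"
    unfolding f0'_def[abs_def] f0''_def using \<open>5 + 3 * x\<^sup>2 \<noteq> 0\<close>
    by (auto intro!: derivative_eq_intros simp: divide_simps power2_eq_square power3_eq_cube)
      (simp add: algebra_simps)
qed

lemma translation_mode_f0:
  "translation_mode f0 x = 80 * x\<^sup>2 / (5 + 3 * x\<^sup>2)\<^sup>2"
  using f0_derivatives(1)[of x, THEN DERIV_imp_deriv]
  by (simp add: translation_mode_def f0'_def power2_eq_square)

text \<open>The Yang-Mills equation for \<open>\<psi>(t, r) = f(\<rho>)\<close> with \<open>\<rho> = r / (1 - t)\<close>, multiplied by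
  \<open>(1 - t)\<^sup>2\<close>.\<close>

lemma self_similar_profile_equation:
  assumes "x \<noteq> 0"
  shows "(x\<^sup>2 - 1) * f0'' x + (2 * x - 2 / x) * f0' x + 3 * f0 x * (f0 x + 1) * (f0 x + 2) / x\<^sup>2 = 0"
proof -
  define D where "D = 5 + 3 * x\<^sup>2"
  have "D > 0" by (simp add: D_def add_pos_nonneg)
  have fs: "f0 x = - (8 * x\<^sup>2 / D)" "f0' x = - (80 * x / D\<^sup>2)" "f0'' x = 80 * (9 * x\<^sup>2 - 5) / D ^ 3"
    by (simp_all add: f0_def f0'_def f0''_def D_def)
  have "(x\<^sup>2 - 1) * f0'' x + (2 * x - 2 / x) * f0' x + 3 * f0 x * (f0 x + 1) * (f0 x + 2) / x\<^sup>2
      = (80 * (x\<^sup>2 - 1) * (9 * x\<^sup>2 - 5) - 160 * (x\<^sup>2 - 1) * D - 24 * (D - 8 * x\<^sup>2) * (2 * D - 8 * x\<^sup>2)) / D ^ 3"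
    unfolding fs using assms \<open>D > 0\<close>
    by (simp add: divide_simps) (simp add: algebra_simps eval_nat_numeral)
  also have "80 * (x\<^sup>2 - 1) * (9 * x\<^sup>2 - 5) - 160 * (x\<^sup>2 - 1) * D - 24 * (D - 8 * x\<^sup>2) * (2 * D - 8 * x\<^sup>2) = 0"
    unfolding D_def by algebra
  finally show ?thesis by simp
qed

lemma yang_mills_solution_f0: "yang_mills_solution (self_similar f0)"
  unfolding yang_mills_solution_def
proof (rule exI[where x = "\<lambda>t r. f0' (r / (1 - t)) * (r / (1 - t)\<^sup>2)"],
    rule exI[where x = "\<lambda>t r. f0'' (r / (1 - t)) * (r / (1 - t)\<^sup>2)\<^sup>2 + f0' (r / (1 - t)) * (2 * r / (1 - t) ^ 3)"],
    rule exI[where x = "\<lambda>t r. f0' (r / (1 - t)) / (1 - t)"],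
    rule exI[where x = "\<lambda>t r. f0'' (r / (1 - t)) / (1 - t)\<^sup>2"], intro allI impI conjI)
  fix t r :: real
  assume t: "t < 1" and r: "0 < r"
  have dt: "((\<lambda>s. r / (1 - s)) has_real_derivative r / (1 - t)\<^sup>2) (at t)"
    using t by (auto intro!: derivative_eq_intros simp: power2_eq_square)
  have dt2: "((\<lambda>s. r / (1 - s)\<^sup>2) has_real_derivative 2 * r / (1 - t) ^ 3) (at t)"
    using t by (auto intro!: derivative_eq_intros simp: divide_simps power2_eq_square power3_eq_cube)
      (simp add: algebra_simps)
  have dr: "((\<lambda>s. s / (1 - t)) has_real_derivative 1 / (1 - t)) (at r)"
    using t by (auto intro!: derivative_eq_intros)
  show "((\<lambda>s. self_similar f0 s r) has_real_derivative f0' (r / (1 - t)) * (r / (1 - t)\<^sup>2)) (at t)"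
    unfolding self_similar_def by (rule DERIV_chain2[OF f0_derivatives(1) dt])
  show "((\<lambda>s. f0' (r / (1 - s)) * (r / (1 - s)\<^sup>2)) has_real_derivative
      f0'' (r / (1 - t)) * (r / (1 - t)\<^sup>2)\<^sup>2 + f0' (r / (1 - t)) * (2 * r / (1 - t) ^ 3)) (at t)"
    by (rule DERIV_cong[OF DERIV_mult[OF DERIV_chain2[OF f0_derivatives(2) dt] dt2]])
      (simp add: power2_eq_square algebra_simps)
  show "((\<lambda>s. self_similar f0 t s) has_real_derivative f0' (r / (1 - t)) / (1 - t)) (at r)"
    unfolding self_similar_def
    by (rule DERIV_cong[OF DERIV_chain2[OF f0_derivatives(1) dr]]) simp
  show "((\<lambda>s. f0' (s / (1 - t)) / (1 - t)) has_real_derivative f0'' (r / (1 - t)) / (1 - t)\<^sup>2) (at r)"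
    by (rule DERIV_cong[OF DERIV_cdivide[OF DERIV_chain2[OF f0_derivatives(2) dr]]])
      (simp add: power2_eq_square)
  define T x where "T = 1 - t" and "x = r / T"
  have "T > 0" "x > 0" using t r by (simp_all add: T_def x_def)
  have rT: "r = x * T" using \<open>T > 0\<close> by (simp add: x_def)
  have "f0'' x * (r / T\<^sup>2)\<^sup>2 + f0' x * (2 * r / T ^ 3) - f0'' x / T\<^sup>2 - 2 / r * (f0' x / T)
      + 3 * f0 x * (f0 x + 1) * (f0 x + 2) / r\<^sup>2
      = ((x\<^sup>2 - 1) * f0'' x + (2 * x - 2 / x) * f0' x + 3 * f0 x * (f0 x + 1) * (f0 x + 2) / x\<^sup>2) / T\<^sup>2"
    unfolding rT using \<open>T > 0\<close> \<open>x > 0\<close>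
    by (simp add: divide_simps power2_eq_square power3_eq_cube) (simp add: algebra_simps)
  also have "\<dots> = 0" using self_similar_profile_equation[of x] \<open>x > 0\<close> by simp
  finally show "f0'' (r / (1 - t)) * (r / (1 - t)\<^sup>2)\<^sup>2 + f0' (r / (1 - t)) * (2 * r / (1 - t) ^ 3)
      - f0'' (r / (1 - t)) / (1 - t)\<^sup>2 - 2 / r * (f0' (r / (1 - t)) / (1 - t))
      + 3 * self_similar f0 t r * (self_similar f0 t r + 1) * (self_similar f0 t r + 2) / r\<^sup>2 = 0"
    unfolding self_similar_def T_def x_def .
qed

section \<open>The translation mode\<close>

text \<open>The derivatives of all orders that \<open>C_infinity_on\<close> asks for exist at once when the function
  belongs to a family in which every member has a derivative in the family. For \<open>u\<^sub>1\<close> the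
  family consists of the quotients of polynomials by powers of \<open>5 + 3 \<rho>\<^sup>2\<close>.\<close>

lemma C_infinity_on_of_closed_under_derivatives:
  fixes F :: "(real \<Rightarrow> 'a::real_normed_vector) set"
  assumes closed: "\<And>f. f \<in> F \<Longrightarrow> \<exists>g\<in>F. \<forall>x\<in>S. (f has_vector_derivative g x) (at x within S)"
    and "u \<in> F"
  shows "C_infinity_on S u"
proof -
  obtain d where d: "\<And>f. f \<in> F \<Longrightarrow> d f \<in> F \<and> (\<forall>x\<in>S. (f has_vector_derivative d f x) (at x within S))"
    using closed by metis
  have "(d ^^ n) u \<in> F" for n
    using d \<open>u \<in> F\<close> by (induction n) auto
  then show ?thesis
    unfolding C_infinity_on_def using d by (intro exI[where x = "\<lambda>n. (d ^^ n) u"]) auto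
qed

lemma C_infinity_on_translation_mode:
  "C_infinity_on S (\<lambda>x. complex_of_real (translation_mode f0 x))"
proof (rule C_infinity_on_of_closed_under_derivatives)
  let ?F = "{\<lambda>x. complex_of_real (poly p x / (5 + 3 * x\<^sup>2) ^ Suc k) |p k. True}"
  show "(\<lambda>x. complex_of_real (translation_mode f0 x)) \<in> ?F"
    by (rule CollectI, intro exI[where x = "[:0, 0, 80:]"] exI[where x = 1])
      (simp add: translation_mode_f0 fun_eq_iff power2_eq_square)
  fix f assume "f \<in> ?F"
  then obtain p k where f: "f = (\<lambda>x. complex_of_real (poly p x / (5 + 3 * x\<^sup>2) ^ Suc k))"
    by blast
  define q where "q = pderiv p * [:5, 0, 3:] - smult (of_nat (Suc k)) (p * [:0, 6:])"
  have "(f has_vector_derivative complex_of_real (poly q x / (5 + 3 * x\<^sup>2) ^ Suc (Suc k))) (at x within S)" for x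
  proof -
    define D where "D = 5 + 3 * x\<^sup>2"
    have "D > 0" by (simp add: D_def add_pos_nonneg)
    have den: "((\<lambda>x. (5 + 3 * x\<^sup>2) ^ Suc k) has_real_derivative real (Suc k) * D ^ k * (6 * x)) (at x within S)"
      by (rule DERIV_cong[OF DERIV_power]) (auto intro!: derivative_eq_intros simp: D_def)
    have "((\<lambda>x. poly p x / (5 + 3 * x\<^sup>2) ^ Suc k) has_real_derivative
        poly q x / D ^ Suc (Suc k)) (at x within S)"
      by (rule DERIV_cong[OF DERIV_divide[OF has_field_derivative_at_within[OF poly_DERIV] den]])
        (use \<open>D > 0\<close> in \<open>simp_all add: D_def[symmetric] q_def divide_simps\<close>,
          auto simp: D_def power2_eq_square algebra_simps)
    then show ?thesis
      unfolding f D_def by (intro has_vector_derivative_of_real) (simp add: has_real_derivative_iff_has_vector_derivative)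
  qed
  then show "\<exists>g\<in>?F. \<forall>x\<in>S. (f has_vector_derivative g x) (at x within S)"
    by (intro bexI[where x = "\<lambda>x. complex_of_real (poly q x / (5 + 3 * x\<^sup>2) ^ Suc (Suc k))"]) blast+
qed

lemma unstable_mode_translation_mode:
  "unstable_mode f0 1 (\<lambda>x. complex_of_real (translation_mode f0 x))"
  unfolding unstable_mode_def
proof (intro conjI ballI)
  show "\<exists>x\<in>{0..1}. complex_of_real (translation_mode f0 x) \<noteq> 0"
    by (rule bexI[where x = 1]) (simp_all add: translation_mode_f0)
  show "mode_equation f0 1 (\<lambda>x. complex_of_real (translation_mode f0 x)) x" if x: "x \<in> {0<..<1}" for x
  proof -
    define D where "D = 5 + 3 * x\<^sup>2"
    have "D > 0" using denominator_pos[of x] by (simp add: D_def)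
    define v1 where "v1 = (\<lambda>x::real. 160 * x * (5 - 3 * x\<^sup>2) / (5 + 3 * x\<^sup>2) ^ 3)"
    define v2 where "v2 = 160 * (25 - 120 * x\<^sup>2 + 27 * x ^ 4) / D ^ 4"
    have "((\<lambda>x. complex_of_real (translation_mode f0 x)) has_vector_derivative of_real (v1 z)) (at z)" for z
      unfolding translation_mode_f0 v1_def using denominator_pos[of z]
      by (intro has_vector_derivative_of_real)
        (auto intro!: derivative_eq_intros simp: divide_simps eval_nat_numeral, simp add: algebra_simps)
    then have first: "vector_derivative (\<lambda>x. complex_of_real (translation_mode f0 x)) (at z) = of_real (v1 z)" for z
      by (rule vector_derivative_at)
    have "((\<lambda>x. complex_of_real (v1 x)) has_vector_derivative of_real v2) (at x)"
      unfolding v1_def v2_def D_def using denominator_pos[of x]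
      by (intro has_vector_derivative_of_real)
        (auto intro!: derivative_eq_intros simp: divide_simps eval_nat_numeral, simp add: algebra_simps)
    then have second: "vector_derivative (\<lambda>x. complex_of_real (v1 x)) (at x) = of_real v2"
      by (rule vector_derivative_at)
    have "- (1 - x\<^sup>2) * (v2 + 2 / x * v1 x) + 2 * x * v1 x + 2 * translation_mode f0 x
        + potential f0 x / x\<^sup>2 * translation_mode f0 x
      = (- (1 - x\<^sup>2) * (160 * (25 - 120 * x\<^sup>2 + 27 * x ^ 4) + 320 * (5 - 3 * x\<^sup>2) * D)
        + 320 * x\<^sup>2 * (5 - 3 * x\<^sup>2) * D + 160 * x\<^sup>2 * D\<^sup>2 + 480 * (25 - 90 * x\<^sup>2 + 33 * x ^ 4)) / D ^ 4"
      unfolding translation_mode_f0 potential_f0 v1_def v2_def D_def[symmetric]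
      using \<open>D > 0\<close> x by (simp add: divide_simps) (simp add: algebra_simps eval_nat_numeral)
    also have "- (1 - x\<^sup>2) * (160 * (25 - 120 * x\<^sup>2 + 27 * x ^ 4) + 320 * (5 - 3 * x\<^sup>2) * D)
        + 320 * x\<^sup>2 * (5 - 3 * x\<^sup>2) * D + 160 * x\<^sup>2 * D\<^sup>2 + 480 * (25 - 90 * x\<^sup>2 + 33 * x ^ 4) = 0"
      unfolding D_def by algebra
    finally have "- (1 - x\<^sup>2) * (v2 + 2 / x * v1 x) + 2 * x * v1 x + 2 * translation_mode f0 x
        + potential f0 x / x\<^sup>2 * translation_mode f0 x = 0" by simp
    then have "complex_of_real (- (1 - x\<^sup>2) * (v2 + 2 / x * v1 x) + 2 * x * v1 x + 2 * translation_mode f0 x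
        + potential f0 x / x\<^sup>2 * translation_mode f0 x) = 0" by (simp only: of_real_0)
    then show ?thesis
      unfolding mode_equation_def Let_def first second by simp
  qed
qed (simp_all add: C_infinity_on_translation_mode)

section \<open>Rigidity of half-wave systems\<close>

text \<open>Why the sign conditions at the end points leave no room: \<open>(1 - x\<^sup>2)\<^bsup>\<sigma>\<^esup> H\<close> is nondecreasing and
  starts at \<open>0\<close>, so \<open>H \<ge> 0\<close> on \<open>[0, 1)\<close>, which by continuity turns \<open>H(1) \<le> 0\<close> into
  \<open>H(1) = 0\<close>. As the weight is at most \<open>1\<close>, the nondecreasing function then also tends to \<open>0\<close> at
  \<open>1\<close>. It is therefore zero, for \<open>\<sigma> = 0\<close> as well as for \<open>\<sigma> > 0\<close>.\<close>

lemma weighted_monotone_rigidity: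
  fixes H R :: "real \<Rightarrow> real" and \<sigma> :: real
  assumes cont: "continuous_on {0..1} H" and "H 0 = 0" and "H 1 \<le> 0" and "\<sigma> \<ge> 0"
    and deriv: "\<And>x. x \<in> {0<..<1} \<Longrightarrow>
      \<exists>H'. (H has_real_derivative H') (at x) \<and> (1 - x\<^sup>2) * H' - 2 * \<sigma> * x * H x = R x"
    and nonneg: "\<And>x. x \<in> {0<..<1} \<Longrightarrow> R x \<ge> 0"
    and x: "x \<in> {0<..<1}"
  shows "R x = 0"
proof -
  define F where "F = (\<lambda>x. (1 - x\<^sup>2) powr \<sigma> * H x)"
  have sq: "1 - z\<^sup>2 > 0" if "0 \<le> z" "z < 1" for z :: real
    using that by (simp add: abs_square_less_1)
  have F_deriv: "\<exists>F'. (F has_real_derivative F') (at z) \<and> F' \<ge> 0" if z: "0 < z" "z < 1" for z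
  proof -
    obtain H' where H': "(H has_real_derivative H') (at z)" "(1 - z\<^sup>2) * H' - 2 * \<sigma> * z * H z = R z"
      using deriv z by (metis greaterThanLessThan_iff)
    have pos: "1 - z\<^sup>2 > 0" using sq z by simp
    \<comment> \<open>The weight is an integrating factor.\<close>
    have "(F has_real_derivative
        (1 - z\<^sup>2) powr \<sigma> * (\<sigma> * (- (2 * z)) / (1 - z\<^sup>2)) * H z + (1 - z\<^sup>2) powr \<sigma> * H') (at z)"
      unfolding F_def using pos H'(1)
      by (auto intro!: derivative_eq_intros simp: powr_diff field_simps)
    also have "(1 - z\<^sup>2) powr \<sigma> * (\<sigma> * (- (2 * z)) / (1 - z\<^sup>2)) * H z + (1 - z\<^sup>2) powr \<sigma> * H'
        = (1 - z\<^sup>2) powr \<sigma> * R z / (1 - z\<^sup>2)"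
      using pos by (simp add: H'(2)[symmetric] divide_simps) (simp add: algebra_simps)
    finally show ?thesis
      using nonneg[of z] pos z
      by (intro exI[where x = "(1 - z\<^sup>2) powr \<sigma> * R z / (1 - z\<^sup>2)"]) simp
  qed
  have F_mono: "F a \<le> F b" if "0 \<le> a" "a \<le> b" "b < 1" for a b
  proof (rule DERIV_nonneg_imp_increasing_open[OF \<open>a \<le> b\<close>])
    show "\<exists>F'. DERIV F z :> F' \<and> F' \<ge> 0" if "a < z" "z < b" for z
      using F_deriv that \<open>0 \<le> a\<close> \<open>b < 1\<close> by simp
    have "1 - z\<^sup>2 \<noteq> 0" if "z \<in> {a..b}" for z
      using sq[of z] that \<open>0 \<le> a\<close> \<open>b < 1\<close> by simp
    moreover have "continuous_on {a..b} H"
      using continuous_on_subset[OF cont] that by auto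
    ultimately show "continuous_on {a..b} F"
      unfolding F_def by (intro continuous_intros) auto
  qed
  have F_nonneg: "F z \<ge> 0" if "0 \<le> z" "z < 1" for z
    using F_mono[of 0 z] that \<open>H 0 = 0\<close> by (simp add: F_def)
  have H_nonneg: "H z \<ge> 0" if "0 \<le> z" "z < 1" for z
    using F_nonneg[OF that] sq[OF that] by (simp add: F_def zero_le_mult_iff)
  have lim: "(H \<longlongrightarrow> H 1) (at_left 1)"
  proof -
    have "(H \<longlongrightarrow> H 1) (at 1 within {0..1})"
      using cont by (simp add: continuous_on_def)
    then show ?thesis
      by (simp add: at_within_Icc_at_left)
  qed
  have left: "eventually (\<lambda>z. z \<in> {x<..<1}) (at_left (1::real))"
    using x eventually_at_left_field by fastforce
  have "H 1 \<ge> 0"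
    by (rule tendsto_lowerbound[OF lim eventually_mono[OF left]])
       (use x H_nonneg in auto)
  with \<open>H 1 \<le> 0\<close> have "H 1 = 0" by simp
  have Fz: "F z = 0" if z: "0 < z" "z < 1" for z
  proof -
    have "eventually (\<lambda>w. w \<in> {z<..<1}) (at_left (1::real))"
      using z eventually_at_left_field by fastforce
    moreover have "F z \<le> H w" if "w \<in> {z<..<1}" for w
    proof -
      have "(1 - w\<^sup>2) powr \<sigma> \<le> 1"
        using sq[of w] that z \<open>\<sigma> \<ge> 0\<close> powr_mono2[of \<sigma> "1 - w\<^sup>2" 1] by simp
      then have "F w \<le> H w"
        unfolding F_def using H_nonneg[of w] that z mult_right_mono[of _ 1 "H w"] by simp
      then show ?thesis
        using F_mono[of z w] that z by simp
    qed
    ultimately have "F z \<le> H 1"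
      using tendsto_lowerbound[OF lim] eventually_mono by (metis (mono_tags, lifting) trivial_limit_at_left_real)
    then show ?thesis
      using \<open>H 1 = 0\<close> F_nonneg[of z] z by simp
  qed
  have H_zero: "H z = 0" if "0 < z" "z < 1" for z
    using Fz[OF that] sq[of z] that by (simp add: F_def)
  obtain H' where H': "(H has_real_derivative H') (at x)" "(1 - x\<^sup>2) * H' - 2 * \<sigma> * x * H x = R x"
    using deriv x by blast
  have "(H has_real_derivative 0) (at x)"
    by (rule has_field_derivative_transform_within_open[where f = "\<lambda>_. 0" and S = "{0<..<1}"])
       (use x H_zero in auto)
  then have "H' = 0"
    using H'(1) DERIV_unique by blast
  then show ?thesis
    using H'(2) H_zero x by simp
qed

text \<open>The functional \<open>H\<close> in the proof combines the outgoing null energy \<open>|P|\<^sup>2\<close> with the phase flux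
  \<open>Im (cnj P y)\<close>. The derivative of either contains \<open>Re (cnj P y)\<close>, with coefficients
  proportional to \<open>Q\<close> and to \<open>\<omega>\<close>; the choice \<open>m = 1 / ((1 + x)\<^sup>2 Q)\<close> is the one for which
  these terms cancel. What remains is a multiple of \<open>|P|\<^sup>2\<close>, nonnegative for every
  \<open>\<sigma> = Re \<lambda> \<ge> 0\<close> because \<open>m\<close> increases. The factor \<open>\<omega>\<close> in front of the flux makes the
  sign of \<open>H(1)\<close> independent of the sign of \<open>\<omega>\<close>.\<close>

lemma nonreal_half_wave_rigidity:
  fixes y P :: "real \<Rightarrow> complex" and Q m m' :: "real \<Rightarrow> real" and lam :: complex
  assumes lam: "Re lam \<ge> 0" "Im lam \<noteq> 0"
    and cont: "continuous_on {0..1} y" "continuous_on {0..1} P" "continuous_on {0..1} m"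
    and y_deriv: "\<And>x. x \<in> {0<..<1} \<Longrightarrow>
      (y has_vector_derivative (P x - (lam - 1) * y x) / of_real (1 + x)) (at x)"
    and P_deriv: "\<And>x. x \<in> {0<..<1} \<Longrightarrow>
      (P has_vector_derivative (lam * P x + of_real (Q x) * y x) / of_real (1 - x)) (at x)"
    and m_deriv: "\<And>x. x \<in> {0<..<1} \<Longrightarrow> (m has_real_derivative m' x) (at x)"
    and m_pos: "\<And>x. x \<in> {0<..<1} \<Longrightarrow> m x > 0" and m'_pos: "\<And>x. x \<in> {0<..<1} \<Longrightarrow> m' x > 0"
    and mQ: "\<And>x. x \<in> {0<..1} \<Longrightarrow> m x * (1 + x)\<^sup>2 * Q x = 1"
    and left: "y 0 = 0" "m 0 = 0"
    and right: "lam * P 1 + of_real (Q 1) * y 1 = 0" "Q 1 > 0"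
    and x: "x \<in> {0<..<1}"
  shows "y x = 0"
proof -
  define \<sigma> \<omega> where "\<sigma> = Re lam" and "\<omega> = Im lam"
  have lam_eq: "lam = Complex \<sigma> \<omega>" by (simp add: \<sigma>_def \<omega>_def)
  define H where "H = (\<lambda>x. \<omega>\<^sup>2 * m x * (cmod (P x))\<^sup>2 + \<omega> * Im (cnj (P x) * y x) / (1 + x))"
  define R where "R = (\<lambda>x. \<omega>\<^sup>2 * ((1 - x\<^sup>2) * m' x + 2 * \<sigma> * m x) * (cmod (P x))\<^sup>2)"
  have sq: "1 - z\<^sup>2 > 0" if "z \<in> {0<..<1}" for z :: real
    using that by (simp add: abs_square_less_1)
  have R_zero: "R z = 0" if z: "z \<in> {0<..<1}" for z
  proof (rule weighted_monotone_rigidity[where H = H and \<sigma> = \<sigma>, OF _ _ _ _ _ _ z])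
    show "continuous_on {0..1} H"
      unfolding H_def using cont by (intro continuous_intros) auto
    show "H 0 = 0" by (simp add: H_def left)
    show "\<sigma> \<ge> 0" using lam by (simp add: \<sigma>_def)
    show "R x \<ge> 0" if "x \<in> {0<..<1}" for x
      unfolding R_def using m_pos[OF that] m'_pos[OF that] sq[OF that] \<open>\<sigma> \<ge> 0\<close>
      by (intro mult_nonneg_nonneg add_nonneg_nonneg) auto
    show "H 1 \<le> 0"
    proof -
      define q where "q = Q 1"
      have "lam \<noteq> 0" using lam by auto
      then have P1: "P 1 = - of_real q * y 1 / lam"
        using right(1) unfolding q_def by (simp add: field_simps add_eq_0_iff)
      have m1: "m 1 = 1 / (4 * q)"
        using mQ[of 1] right(2) by (simp add: q_def field_simps)
      have norm_P: "(cmod (P 1))\<^sup>2 = q\<^sup>2 * (cmod (y 1))\<^sup>2 / (cmod lam)\<^sup>2"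
        unfolding P1 by (simp add: norm_mult norm_divide power_mult_distrib power_divide)
      have "cnj (P 1) * y 1 = - of_real (q * (cmod (y 1))\<^sup>2 / (cmod lam)\<^sup>2) * lam"
        using \<open>lam \<noteq> 0\<close> unfolding P1 of_real_divide of_real_mult complex_norm_square
        by (simp add: field_simps)
      then have Im_P: "Im (cnj (P 1) * y 1) = - q * (cmod (y 1))\<^sup>2 / (cmod lam)\<^sup>2 * \<omega>"
        by (simp add: \<omega>_def)
      \<comment> \<open>The flux term is minus twice the energy term.\<close>
      have "H 1 = - (q * \<omega>\<^sup>2 * (cmod (y 1))\<^sup>2 / (4 * (cmod lam)\<^sup>2))"
        unfolding H_def norm_P Im_P m1 using right(2) \<open>lam \<noteq> 0\<close>
        by (simp add: q_def field_simps power2_eq_square)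
      also have "\<dots> \<le> 0" using right(2) by (simp add: q_def)
      finally show ?thesis .
    qed
    show "\<exists>H'. (H has_real_derivative H') (at x) \<and> (1 - x\<^sup>2) * H' - 2 * \<sigma> * x * H x = R x"
      if x: "x \<in> {0<..<1}" for x
    proof -
      define a b c d where "a = Re (y x)" and "b = Im (y x)" and "c = Re (P x)" and "d = Im (P x)"
      define a' b' c' d' where
        "a' = (c - (\<sigma> - 1) * a + \<omega> * b) / (1 + x)" and "b' = (d - (\<sigma> - 1) * b - \<omega> * a) / (1 + x)" and
        "c' = (\<sigma> * c - \<omega> * d + Q x * a) / (1 - x)" and "d' = (\<sigma> * d + \<omega> * c + Q x * b) / (1 - x)"
      have ab: "((\<lambda>x. Re (y x)) has_real_derivative a') (at x)" "((\<lambda>x. Im (y x)) has_real_derivative b') (at x)"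
        using y_deriv[OF x, unfolded has_vector_derivative_complex_iff Re_divide_of_real Im_divide_of_real]
        by (simp_all add: lam_eq a'_def b'_def a_def b_def c_def d_def algebra_simps)
      have cd: "((\<lambda>x. Re (P x)) has_real_derivative c') (at x)" "((\<lambda>x. Im (P x)) has_real_derivative d') (at x)"
        using P_deriv[OF x, unfolded has_vector_derivative_complex_iff Re_divide_of_real Im_divide_of_real]
        by (simp_all add: lam_eq c'_def d'_def a_def b_def c_def d_def algebra_simps)
      define H' where "H' = \<omega>\<^sup>2 * (m' x * (c\<^sup>2 + d\<^sup>2) + m x * (2 * c * c' + 2 * d * d'))
        + \<omega> * ((c' * b + c * b' - d' * a - d * a') / (1 + x) - (c * b - d * a) / (1 + x)\<^sup>2)"
      have H_alt: "H = (\<lambda>x. \<omega>\<^sup>2 * m x * ((Re (P x))\<^sup>2 + (Im (P x))\<^sup>2)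
         + \<omega> * (Re (P x) * Im (y x) - Im (P x) * Re (y x)) / (1 + x))"
        by (simp add: H_def cmod_power2)
      have "((\<lambda>x. (Re (P x))\<^sup>2 + (Im (P x))\<^sup>2) has_real_derivative 2 * c * c' + 2 * d * d') (at x)"
        using DERIV_add[OF DERIV_mult[OF cd(1) cd(1)] DERIV_mult[OF cd(2) cd(2)]]
        by (simp add: power2_eq_square c_def d_def algebra_simps)
      note N = DERIV_mult[OF DERIV_cmult[OF m_deriv[OF x], of "\<omega>\<^sup>2"] this]
      have "((\<lambda>x. Re (P x) * Im (y x) - Im (P x) * Re (y x)) has_real_derivative
          c' * b + c * b' - d' * a - d * a') (at x)"
        using DERIV_diff[OF DERIV_mult[OF cd(1) ab(2)] DERIV_mult[OF cd(2) ab(1)]]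
        by (simp add: a_def b_def c_def d_def algebra_simps)
      note G = DERIV_cmult[OF this, of \<omega>]
      have "((\<lambda>x. 1 + x) has_real_derivative 1) (at x)"
        by (auto intro!: derivative_eq_intros)
      note H_deriv = DERIV_add[OF N DERIV_divide[OF G this]]
      have "(H has_real_derivative H') (at x)"
        unfolding H_alt H'_def a_def b_def c_def d_def
        by (rule DERIV_cong[OF H_deriv])
          (use x in \<open>simp_all add: a_def b_def c_def d_def divide_simps power2_eq_square\<close>,
            simp add: algebra_simps)
      moreover have "(1 - x\<^sup>2) * H' - 2 * \<sigma> * x * H x = R x"
      proof -
        have pos: "1 + x > 0" "1 - x > 0" using x by auto
        have Hx: "H x = \<omega>\<^sup>2 * m x * (c\<^sup>2 + d\<^sup>2) + \<omega> * (c * b - d * a) / (1 + x)"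
          by (simp add: H_alt a_def b_def c_def d_def)
        have Rx: "R x = \<omega>\<^sup>2 * ((1 - x\<^sup>2) * m' x + 2 * \<sigma> * m x) * (c\<^sup>2 + d\<^sup>2)"
          by (simp add: R_def cmod_power2 c_def d_def)
        define k u s g where "k = 1 + x" and "u = inverse k" and "s = c * a + d * b" and "g = c * b - d * a"
        have ku: "k * u = 1" using pos by (simp add: k_def u_def)
        have mQk: "m x * k\<^sup>2 * Q x = 1" using mQ[of x] x by (simp add: k_def)
        have A: "a' * k = c - (\<sigma> - 1) * a + \<omega> * b" "b' * k = d - (\<sigma> - 1) * b - \<omega> * a"
          and C: "c' * (1 - x) = \<sigma> * c - \<omega> * d + Q x * a" "d' * (1 - x) = \<sigma> * d + \<omega> * c + Q x * b"
          using pos by (simp_all add: a'_def b'_def c'_def d'_def k_def)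
        \<comment> \<open>\<open>s\<close> and \<open>g\<close> are the real and imaginary part of \<open>cnj P y\<close>. Their coefficients in
          \<open>(1 - x\<^sup>2) H' - 2 \<sigma> x H\<close> are zero: that of \<open>s\<close> by \<open>mQk\<close>, that of \<open>g\<close> because the rates
          \<open>\<sigma> / (1 - x)\<close> of \<open>P\<close> and \<open>(1 - \<sigma>) / (1 + x)\<close> of \<open>y\<close> add up to
          \<open>2 \<sigma> x / (1 - x\<^sup>2) + 1 / (1 + x)\<close>.\<close>
        have "(c * c' + d * d') * (1 - x) = \<sigma> * (c\<^sup>2 + d\<^sup>2) + Q x * s"
          unfolding s_def using C by algebra
        moreover have "(c' * b - d' * a) * (1 - x) = \<sigma> * g - \<omega> * s"
          unfolding s_def g_def using C by algebra
        moreover have "(c * b' - d * a') * k = - (\<sigma> - 1) * g - \<omega> * s"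
          unfolding s_def g_def using A by algebra
        moreover have "H' = \<omega>\<^sup>2 * (m' x * (c\<^sup>2 + d\<^sup>2) + 2 * m x * (c * c' + d * d'))
            + \<omega> * (((c' * b - d' * a) + (c * b' - d * a')) * u - g * u\<^sup>2)"
          unfolding H'_def k_def[symmetric]
          by (simp add: g_def u_def divide_inverse power2_eq_square algebra_simps)
        moreover have "H x = \<omega>\<^sup>2 * m x * (c\<^sup>2 + d\<^sup>2) + \<omega> * g * u"
          by (simp add: Hx g_def u_def k_def divide_inverse)
        moreover have "x = k - 1" by (simp add: k_def)
        ultimately show ?thesis
          unfolding Rx using ku mQk by algebra
      qed
      ultimately show ?thesis by blast
    qed
  qed
  have P_zero: "P z = 0" if z: "z \<in> {0<..<1}" for z
  proof -
    have "(1 - z\<^sup>2) * m' z + 2 * \<sigma> * m z > 0"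
      using m_pos[OF z] m'_pos[OF z] sq[OF z] lam by (intro add_pos_nonneg) (auto simp: \<sigma>_def)
    then show ?thesis
      using R_zero[OF z] lam by (simp add: R_def \<omega>_def)
  qed
  have "(P has_vector_derivative 0) (at x)"
    by (rule has_vector_derivative_transform_within_open[where f = "\<lambda>_. 0" and S = "{0<..<1}"])
       (use x P_zero in auto)
  then have "(lam * P x + of_real (Q x) * y x) / of_real (1 - x) = 0"
    using P_deriv[OF x] vector_derivative_unique_at by blast
  moreover have "Q x \<noteq> 0" using mQ[of x] x by auto
  ultimately show ?thesis using P_zero[OF x] x by auto
qed

text \<open>This is the energy identity of the second order equation
  \<open>- (1 - x\<^sup>2) y'' + 2 \<lambda> x y' + \<lambda> (\<lambda> - 1) y + Q y = 0\<close> tested with \<open>cnj y\<close> against the weight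
  \<open>(1 - x\<^sup>2)\<^bsup>\<lambda> - 1\<^esup>\<close>. The boundary term at \<open>1\<close> has the right sign by the relation that
  smoothness imposes there; for \<open>\<lambda> = 0\<close> that relation is \<open>y(1) = 0\<close>.\<close>

lemma real_half_wave_rigidity:
  fixes y P :: "real \<Rightarrow> complex" and Q :: "real \<Rightarrow> real" and l :: real
  assumes l: "l \<ge> 0"
    and cont: "continuous_on {0..1} y" "continuous_on {0..1} P"
    and y_deriv: "\<And>x. x \<in> {0<..<1} \<Longrightarrow>
      (y has_vector_derivative (P x - (of_real l - 1) * y x) / of_real (1 + x)) (at x)"
    and P_deriv: "\<And>x. x \<in> {0<..<1} \<Longrightarrow>
      (P has_vector_derivative (of_real l * P x + of_real (Q x) * y x) / of_real (1 - x)) (at x)"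
    and Q: "\<And>x. x \<in> {0<..1} \<Longrightarrow> l * (l - 1) + Q x > 0"
    and left: "y 0 = 0"
    and right: "of_real l * P 1 + of_real (Q 1) * y 1 = 0"
    and x: "x \<in> {0<..<1}"
  shows "y x = 0"
proof -
  define H where "H = (\<lambda>x. Re ((P x - (of_real l - 1) * y x) * cnj (y x)) / (1 + x))"
  define R where "R = (\<lambda>x. (1 - x\<^sup>2) * (cmod ((P x - (of_real l - 1) * y x) / of_real (1 + x)))\<^sup>2
    + (l * (l - 1) + Q x) * (cmod (y x))\<^sup>2)"
  have sq: "1 - z\<^sup>2 > 0" if "z \<in> {0<..<1}" for z :: real
    using that by (simp add: abs_square_less_1)
  have "R x = 0"
  proof (rule weighted_monotone_rigidity[where H = H and \<sigma> = l, OF _ _ _ l _ _ x])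
    show "continuous_on {0..1} H"
      unfolding H_def using cont by (intro continuous_intros) auto
    show "H 0 = 0" by (simp add: H_def left)
    show "R x \<ge> 0" if "x \<in> {0<..<1}" for x
    proof -
      have "0 \<le> 1 - x\<^sup>2" "0 \<le> l * (l - 1) + Q x"
        using sq[OF that] Q[of x] that by (auto intro: less_imp_le)
      then show ?thesis
        unfolding R_def by (intro add_nonneg_nonneg[OF mult_nonneg_nonneg mult_nonneg_nonneg]) auto
    qed
    show "H 1 \<le> 0"
    proof (cases "l = 0")
      case True
      then have "y 1 = 0" using right Q[of 1] by simp
      then show ?thesis by (simp add: H_def)
    next
      case False
      define q where "q = Q 1 / l"
      have P1: "P 1 = - (of_real q * y 1)"
        using False right by (simp add: q_def field_simps add_eq_0_iff)
      have quot: "(l * (l - 1) + Q 1) / l = q + (l - 1)"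
        using False by (simp add: q_def field_simps)
      have "(P 1 - (of_real l - 1) * y 1) * cnj (y 1)
          = of_real (- ((l * (l - 1) + Q 1) / l)) * (y 1 * cnj (y 1))"
        unfolding P1 quot by (simp add: algebra_simps)
      also have "\<dots> = of_real (- ((l * (l - 1) + Q 1) / l) * (cmod (y 1))\<^sup>2)"
        by (simp only: complex_norm_square[symmetric] of_real_mult)
      finally have "H 1 = - ((l * (l - 1) + Q 1) / l) * (cmod (y 1))\<^sup>2 / 2"
        by (simp only: H_def Re_complex_of_real) simp
      also have "\<dots> \<le> 0" using Q[of 1] l by (simp add: mult_nonneg_nonneg)
      finally show ?thesis .
    qed
    show "\<exists>H'. (H has_real_derivative H') (at x) \<and> (1 - x\<^sup>2) * H' - 2 * l * x * H x = R x"
      if x: "x \<in> {0<..<1}" for x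
    proof -
      define a b c d where "a = Re (y x)" and "b = Im (y x)" and "c = Re (P x)" and "d = Im (P x)"
      define a' b' c' d' where
        "a' = (c - (l - 1) * a) / (1 + x)" and "b' = (d - (l - 1) * b) / (1 + x)" and
        "c' = (l * c + Q x * a) / (1 - x)" and "d' = (l * d + Q x * b) / (1 - x)"
      have ab: "((\<lambda>x. Re (y x)) has_real_derivative a') (at x)" "((\<lambda>x. Im (y x)) has_real_derivative b') (at x)"
        using y_deriv[OF x, unfolded has_vector_derivative_complex_iff Re_divide_of_real Im_divide_of_real]
        by (simp_all add: a'_def b'_def a_def b_def c_def d_def algebra_simps)
      have cd: "((\<lambda>x. Re (P x)) has_real_derivative c') (at x)" "((\<lambda>x. Im (P x)) has_real_derivative d') (at x)"
        using P_deriv[OF x, unfolded has_vector_derivative_complex_iff Re_divide_of_real Im_divide_of_real]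
        by (simp_all add: c'_def d'_def a_def b_def c_def d_def algebra_simps)
      define N N' where "N = (c * a + d * b) - (l - 1) * (a * a + b * b)"
        and "N' = (c' * a + c * a' + d' * b + d * b') - (l - 1) * (2 * a * a' + 2 * b * b')"
      have H_alt: "H = (\<lambda>x. ((Re (P x) * Re (y x) + Im (P x) * Im (y x))
          - (l - 1) * (Re (y x) * Re (y x) + Im (y x) * Im (y x))) / (1 + x))"
        by (simp add: H_def algebra_simps)
      have "((\<lambda>x. (Re (P x) * Re (y x) + Im (P x) * Im (y x))
          - (l - 1) * (Re (y x) * Re (y x) + Im (y x) * Im (y x))) has_real_derivative N') (at x)"
        using DERIV_diff[OF DERIV_add[OF DERIV_mult[OF cd(1) ab(1)] DERIV_mult[OF cd(2) ab(2)]]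
            DERIV_cmult[OF DERIV_add[OF DERIV_mult[OF ab(1) ab(1)] DERIV_mult[OF ab(2) ab(2)]], of "l - 1"]]
        by (rule DERIV_cong) (simp add: N'_def a_def b_def c_def d_def algebra_simps)
      moreover have "((\<lambda>x. 1 + x) has_real_derivative 1) (at x)"
        by (auto intro!: derivative_eq_intros)
      ultimately have "(H has_real_derivative (N' * (1 + x) - N * 1) / ((1 + x) * (1 + x))) (at x)"
        unfolding H_alt N_def a_def b_def c_def d_def using x by (intro DERIV_divide) auto
      moreover have "(1 - x\<^sup>2) * ((N' * (1 + x) - N * 1) / ((1 + x) * (1 + x))) - 2 * l * x * H x = R x"
      proof -
        have pos: "1 + x > 0" "1 - x > 0" using x by auto
        have Hx: "H x = N / (1 + x)"
          by (simp add: H_alt N_def a_def b_def c_def d_def)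
        have Rx: "R x = (1 - x\<^sup>2) * (a'\<^sup>2 + b'\<^sup>2) + (l * (l - 1) + Q x) * (a\<^sup>2 + b\<^sup>2)"
          unfolding R_def cmod_power2 Re_divide_of_real Im_divide_of_real
          by (simp add: a'_def b'_def a_def b_def c_def d_def)
        define k u where "k = 1 + x" and "u = inverse k"
        have ku: "k * u = 1" using pos by (simp add: k_def u_def)
        have A: "a' * k = c - (l - 1) * a" "b' * k = d - (l - 1) * b"
          and C: "c' * (1 - x) = l * c + Q x * a" "d' * (1 - x) = l * d + Q x * b"
          using pos by (simp_all add: a'_def b'_def c'_def d'_def k_def)
        have N_alt: "N = k * (a * a' + b * b')"
          unfolding N_def using A by algebra
        have Hx': "H x = a * a' + b * b'"
          unfolding Hx N_alt using pos by (simp add: k_def)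
        have "(N' * (1 + x) - N * 1) / ((1 + x) * (1 + x)) = (N' - (a * a' + b * b')) * u"
          unfolding N_alt u_def using pos by (simp add: k_def divide_simps) (simp add: algebra_simps)
        moreover have "(1 - x\<^sup>2) * ((N' - (a * a' + b * b')) * u) = (1 - x) * (N' - (a * a' + b * b'))"
          using ku unfolding k_def by algebra
        moreover have "(1 - x) * N' = l * (a * c + b * d) + Q x * (a\<^sup>2 + b\<^sup>2)
            + (1 - x) * (c * a' + d * b' - 2 * (l - 1) * (a * a' + b * b'))"
          unfolding N'_def using C by algebra
        ultimately show ?thesis
          unfolding Rx Hx' using A k_def by algebra
      qed
      ultimately show ?thesis by blast
    qed
  qed
  moreover have "(1 - x\<^sup>2) * (cmod ((P x - (of_real l - 1) * y x) / of_real (1 + x)))\<^sup>2 \<ge> 0"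
    using sq[OF x] by simp
  ultimately have "(l * (l - 1) + Q x) * (cmod (y x))\<^sup>2 \<le> 0"
    unfolding R_def by linarith
  then show ?thesis using Q[of x] x by (simp add: mult_le_0_iff)
qed

section \<open>The partner potential\<close>

text \<open>The logarithmic derivative with respect to \<open>artanh x\<close> of \<open>h\<^sub>0 = x\<^sup>3 / (5 + 3 x\<^sup>2)\<^sup>2\<close>, which is
  \<open>x u\<^sub>1(x)\<close> up to a constant. The numerator is \<open>(1 - x\<^sup>2) (15 - 3 x\<^sup>2)\<close>.\<close>

definition superpotential :: "real \<Rightarrow> real" where
  "superpotential x = (15 - 18 * x\<^sup>2 + 3 * x ^ 4) / (x * (5 + 3 * x\<^sup>2))"

definition superpotential' :: "real \<Rightarrow> real" where
  "superpotential' x = ((- 36 * x + 12 * x ^ 3) * (x * (5 + 3 * x\<^sup>2))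
     - (15 - 18 * x\<^sup>2 + 3 * x ^ 4) * (5 + 9 * x\<^sup>2)) / (x * (5 + 3 * x\<^sup>2))\<^sup>2"

lemma superpotential_deriv:
  assumes "x \<noteq> 0"
  shows "(superpotential has_real_derivative superpotential' x) (at x)"
proof -
  have "((\<lambda>x. 15 - 18 * x\<^sup>2 + 3 * x ^ 4) has_real_derivative - 36 * x + 12 * x ^ 3) (at x)"
    by (auto intro!: derivative_eq_intros)
  moreover have "((\<lambda>x. x * (5 + 3 * x\<^sup>2)) has_real_derivative 5 + 9 * x\<^sup>2) (at x)"
    by (auto intro!: derivative_eq_intros simp: power2_eq_square)
  moreover have "x * (5 + 3 * x\<^sup>2) \<noteq> 0" using assms denominator_pos[of x] by simp
  ultimately show ?thesis
    unfolding superpotential_def[abs_def] superpotential'_def power2_eq_square[of "x * _"]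
    by (rule DERIV_divide)
qed

definition partner_potential :: "real \<Rightarrow> real" where
  "partner_potential x = 6 * (50 - 15 * x\<^sup>2 - 3 * x ^ 6) / (x * (5 + 3 * x\<^sup>2))\<^sup>2"

text \<open>Since \<open>1 - x\<^sup>2\<close> times the derivative in \<open>x\<close> is the derivative in \<open>artanh x\<close>, this identifies
  the left hand side as the supersymmetric partner \<open>W\<^sup>2 - W'\<close> of the potential \<open>W\<^sup>2 + W'\<close>
  of the mode equation.\<close>

lemma partner_potential_riccati:
  assumes "x \<noteq> 0"
  shows "(1 - x\<^sup>2) * partner_potential x = (superpotential x)\<^sup>2 - (1 - x\<^sup>2) * superpotential' x"
proof -
  define E where "E = x * (5 + 3 * x\<^sup>2)"
  have "E \<noteq> 0" using assms denominator_pos[of x] by (simp add: E_def)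
  then have "(superpotential x)\<^sup>2 - (1 - x\<^sup>2) * superpotential' x
    = ((15 - 18 * x\<^sup>2 + 3 * x ^ 4)\<^sup>2 - (1 - x\<^sup>2) * ((- 36 * x + 12 * x ^ 3) * E
      - (15 - 18 * x\<^sup>2 + 3 * x ^ 4) * (5 + 9 * x\<^sup>2))) / E\<^sup>2"
    unfolding superpotential_def superpotential'_def E_def[symmetric] by (simp add: field_simps)
  also have "(15 - 18 * x\<^sup>2 + 3 * x ^ 4)\<^sup>2 - (1 - x\<^sup>2) * ((- 36 * x + 12 * x ^ 3) * E
      - (15 - 18 * x\<^sup>2 + 3 * x ^ 4) * (5 + 9 * x\<^sup>2)) = (1 - x\<^sup>2) * (6 * (50 - 15 * x\<^sup>2 - 3 * x ^ 6))"
    unfolding E_def by algebra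
  finally show ?thesis by (simp add: partner_potential_def E_def)
qed

lemma partner_numerator_ge:
  assumes "x \<in> {0..1::real}"
  shows "50 - 15 * x\<^sup>2 - 3 * x ^ 6 \<ge> 32"
proof -
  have "x\<^sup>2 \<le> 1" "x ^ 6 \<le> 1" using assms by (auto intro: power_le_one)
  then show ?thesis by linarith
qed

text \<open>The constant \<open>1/4\<close> is what makes \<open>l (l - 1) + Q\<close> positive for every real \<open>l\<close>.\<close>

lemma partner_potential_lower_bound:
  assumes "x \<in> {0<..1}"
  shows "partner_potential x > 1 / 4"
proof -
  define E where "E = x * (5 + 3 * x\<^sup>2)"
  have "x * x\<^sup>2 \<le> 1" "x > 0" "x \<le> 1"
    using assms by (auto intro!: mult_le_one power_le_one)
  then have E: "0 < E" "E \<le> 8"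
    using denominator_pos[of x] by (simp_all add: E_def distrib_left mult.left_commute add_pos_pos)
  then have "E\<^sup>2 \<le> 8\<^sup>2" by (intro power_mono) auto
  then show ?thesis
    using E partner_numerator_ge[of x] assms
    unfolding partner_potential_def E_def[symmetric] by (simp add: divide_simps)
qed

text \<open>The reciprocal of \<open>(1 + x)\<^sup>2 Q\<close> for the partner potential \<open>Q\<close>, written so that it
  is continuous at \<open>0\<close>, where \<open>Q\<close> is singular.\<close>

definition partner_weight :: "real \<Rightarrow> real" where
  "partner_weight x = (x / (1 + x))\<^sup>2 * ((5 + 3 * x\<^sup>2)\<^sup>2 / (6 * (50 - 15 * x\<^sup>2 - 3 * x ^ 6)))"

lemma partner_weight_potential:
  assumes "x \<in> {0<..1}"
  shows "partner_weight x * (1 + x)\<^sup>2 * partner_potential x = 1"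
proof -
  define D N where "D = 5 + 3 * x\<^sup>2" and "N = 50 - 15 * x\<^sup>2 - 3 * x ^ 6"
  have "D > 0" "N > 0" "x > 0" "1 + x > 0"
    using assms partner_numerator_ge[of x] denominator_pos[of x] by (auto simp: D_def N_def)
  then show ?thesis
    unfolding partner_weight_def partner_potential_def D_def[symmetric] N_def[symmetric]
    by (simp add: power_divide power_mult_distrib)
qed

text \<open>Both factors increase: \<open>x / (1 + x)\<close> because it is \<open>1 - 1 / (1 + x)\<close>, the other one because its
  numerator increases and its denominator decreases.\<close>

lemma partner_weight_increasing:
  assumes x: "x \<in> {0<..<1}"
  shows "\<exists>m'>0. (partner_weight has_real_derivative m') (at x)"
proof -
  define D N where "D = 5 + 3 * x\<^sup>2" and "N = 50 - 15 * x\<^sup>2 - 3 * x ^ 6"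
  have pos: "D > 0" "N > 0" "x > 0"
    using x partner_numerator_ge[of x] denominator_pos[of x] by (auto simp: D_def N_def)
  have "((\<lambda>x. (x / (1 + x))\<^sup>2) has_real_derivative 2 * (x / (1 + x)) * (1 / (1 + x)\<^sup>2)) (at x)"
    using x by (auto intro!: derivative_eq_intros simp: power2_eq_square divide_simps)
      (simp add: algebra_simps)
  moreover have "((\<lambda>x. (5 + 3 * x\<^sup>2)\<^sup>2) has_real_derivative 12 * x * D) (at x)"
    by (auto intro!: derivative_eq_intros simp: D_def)
  moreover have "((\<lambda>x. 6 * (50 - 15 * x\<^sup>2 - 3 * x ^ 6)) has_real_derivative - 6 * (30 * x + 18 * x ^ 5)) (at x)"
    by (auto intro!: derivative_eq_intros)
  ultimately have "(partner_weight has_real_derivative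
      2 * (x / (1 + x)) * (1 / (1 + x)\<^sup>2) * (D\<^sup>2 / (6 * N))
      + (12 * x * D * (6 * N) - D\<^sup>2 * (- 6 * (30 * x + 18 * x ^ 5))) / (6 * N * (6 * N)) * (x / (1 + x))\<^sup>2) (at x)"
    (is "(_ has_real_derivative ?m') _")
    unfolding partner_weight_def[abs_def] D_def N_def
    using pos by (intro DERIV_mult DERIV_divide) (auto simp: N_def)
  moreover have "0 < 12 * x * D * (6 * N) + D\<^sup>2 * (6 * (30 * x + 18 * x ^ 5))"
    using pos by (intro add_pos_pos mult_pos_pos) auto
  then have "0 < 12 * x * D * (6 * N) - D\<^sup>2 * (- 6 * (30 * x + 18 * x ^ 5))"
    by (simp add: algebra_simps)
  then have "?m' > 0"
    using pos by (intro add_pos_pos mult_pos_pos divide_pos_pos) (assumption | simp)+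
  ultimately show ?thesis by blast
qed

section \<open>The Darboux transformation of a mode\<close>

text \<open>This is \<open>- x u\<^sub>1' / u\<^sub>1\<close>, so that \<open>x u' + k u\<close> vanishes for \<open>u = u\<^sub>1\<close>.\<close>

definition mode_slope :: "real \<Rightarrow> real" where
  "mode_slope x = (6 * x\<^sup>2 - 10) / (5 + 3 * x\<^sup>2)"

lemma mode_slope_deriv: "(mode_slope has_real_derivative 120 * x / (5 + 3 * x\<^sup>2)\<^sup>2) (at x)"
  unfolding mode_slope_def[abs_def] using denominator_pos[of x]
  by (auto intro!: derivative_eq_intros simp: divide_simps power2_eq_square)
    (simp add: algebra_simps)

lemma superpotential_mode_slope:
  assumes "x \<noteq> 0"
  shows "superpotential x * x = (1 - x\<^sup>2) * (1 - mode_slope x)"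
  using denominator_pos[of x] assms
  by (simp add: mode_slope_def superpotential_def divide_simps)
    (simp add: algebra_simps power2_eq_square power4_eq_xxxx)

text \<open>The mode equation for \<open>u\<^sub>1\<close> and \<open>\<lambda> = 1\<close>, expressed through the logarithmic derivative of
  \<open>u\<^sub>1\<close>. In this form the potential can be eliminated from the equation of an arbitrary mode.\<close>

lemma mode_slope_riccati:
  "potential f0 x = (1 - x\<^sup>2) * ((mode_slope x)\<^sup>2 - mode_slope x - x * (120 * x / (5 + 3 * x\<^sup>2)\<^sup>2))
     + 2 * x\<^sup>2 * mode_slope x - 2 * x\<^sup>2"
proof -
  define D n where "D = 5 + 3 * x\<^sup>2" and "n = 6 * x\<^sup>2 - 10"
  have "D > 0" using denominator_pos[of x] by (simp add: D_def)
  have "(1 - x\<^sup>2) * ((n / D)\<^sup>2 - n / D - x * (120 * x / D\<^sup>2)) + 2 * x\<^sup>2 * (n / D) - 2 * x\<^sup>2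
    = ((1 - x\<^sup>2) * (n\<^sup>2 - n * D - 120 * x\<^sup>2) + 2 * x\<^sup>2 * n * D - 2 * x\<^sup>2 * D\<^sup>2) / D\<^sup>2"
    using \<open>D > 0\<close> by (simp add: field_simps power2_eq_square)
  also have "(1 - x\<^sup>2) * (n\<^sup>2 - n * D - 120 * x\<^sup>2) + 2 * x\<^sup>2 * n * D - 2 * x\<^sup>2 * D\<^sup>2
    = 6 * (25 - 90 * x\<^sup>2 + 33 * x ^ 4)"
    unfolding D_def n_def by algebra
  finally show ?thesis
    by (simp add: potential_f0 mode_slope_def D_def n_def)
qed

text \<open>The Darboux transformation as a first order system. In the variable \<open>artanh x\<close> the operators
  \<open>\<partial> - W\<close> and \<open>\<partial> + W\<close> compose to the operator \<open>\<partial>\<^sup>2 - U\<close> of the mode equation, so applying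
  the second one to the transform returns \<open>\<nu>\<^sup>2\<close> times the original function. This is the last
  identity below, and it is all that is needed of the mode equation inside the interval: \<open>u\<close> and the
  transform \<open>y\<close> satisfy two first order equations, from which the derivative of \<open>P\<close> follows by
  means of \<open>partner_potential_riccati\<close>. At the end points the mode equation, multiplied by \<open>x\<^sup>2\<close>, degenerates
  to linear relations between \<open>u\<close> and \<open>u'\<close>, which give the boundary values of \<open>y\<close> and \<open>P\<close>.\<close>

lemma darboux_half_wave_system:
  fixes u0 u1 u2 :: "real \<Rightarrow> complex" and lam :: complex
  assumes cont: "continuous_on {0..1} u0" "continuous_on {0..1} u1" "continuous_on {0..1} u2"
    and u0: "\<And>x. x \<in> {0<..<1} \<Longrightarrow> (u0 has_vector_derivative u1 x) (at x)"
    and u1: "\<And>x. x \<in> {0<..<1} \<Longrightarrow> (u1 has_vector_derivative u2 x) (at x)"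
    and ode: "\<And>x. x \<in> {0..1} \<Longrightarrow> - (1 - of_real x ^ 2) * (of_real x ^ 2 * u2 x + 2 * of_real x * u1 x)
      + 2 * lam * of_real x ^ 3 * u1 x + lam * (lam + 1) * of_real x ^ 2 * u0 x
      + of_real (potential f0 x) * u0 x = 0"
  defines "y \<equiv> \<lambda>x. of_real (1 - x\<^sup>2) * (of_real x * u1 x + of_real (mode_slope x) * u0 x)
      - (lam - 1) * of_real (x\<^sup>2) * u0 x"
  obtains P where
    "continuous_on {0..1} y" "continuous_on {0..1} P" "y 0 = 0"
    "lam * P 1 + of_real (partner_potential 1) * y 1 = 0"
    "\<And>x. x \<in> {0<..<1} \<Longrightarrow>
      (y has_vector_derivative (P x - (lam - 1) * y x) / of_real (1 + x)) (at x)"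
    "\<And>x. x \<in> {0<..<1} \<Longrightarrow>
      (P has_vector_derivative (lam * P x + of_real (partner_potential x) * y x) / of_real (1 - x)) (at x)"
    "\<And>x. x \<in> {0<..<1} \<Longrightarrow> of_real (1 - x) * P x
      = (lam - 1 - of_real (superpotential x)) * y x + (lam - 1)\<^sup>2 * of_real x * u0 x"
proof -
  define \<nu> where "\<nu> = lam - 1"
  define k' where "k' x = 120 * x / (5 + 3 * x\<^sup>2)\<^sup>2" for x :: real
  define yd where "yd = (\<lambda>x. of_real (- 2 * x) * (of_real x * u1 x + of_real (mode_slope x) * u0 x)
    + of_real (1 - x\<^sup>2) * (u1 x + of_real x * u2 x + (of_real (k' x) * u0 x + of_real (mode_slope x) * u1 x))
    - \<nu> * (of_real (2 * x) * u0 x + of_real (x\<^sup>2) * u1 x))"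
  define P where "P = (\<lambda>x. \<nu> * y x + of_real (1 + x) * yd x)"
  have slope_cont: "continuous_on {0..1} mode_slope"
    using mode_slope_deriv DERIV_isCont by (blast intro: continuous_at_imp_continuous_on)
  have y_cont: "continuous_on {0..1} y"
    unfolding y_def using cont slope_cont by (intro continuous_intros) auto
  have P_cont: "continuous_on {0..1} P"
  proof -
    have "5 + 3 * x\<^sup>2 \<noteq> 0" for x :: real using denominator_pos[of x] by simp
    then show ?thesis
      unfolding P_def yd_def k'_def using cont slope_cont y_cont by (intro continuous_intros) auto
  qed
  have y_deriv: "(y has_vector_derivative yd x) (at x)" if x: "x \<in> {0<..<1}" for x
  proof -
    have sq: "((\<lambda>x. complex_of_real (x\<^sup>2)) has_vector_derivative of_real (2 * x)) (at x)"
      "((\<lambda>x. complex_of_real (1 - x\<^sup>2)) has_vector_derivative of_real (- 2 * x)) (at x)"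
      by (intro has_vector_derivative_of_real; auto intro!: derivative_eq_intros)+
    have id: "((\<lambda>x. complex_of_real x) has_vector_derivative 1) (at x)"
      using has_vector_derivative_of_real[OF DERIV_ident, of "at x"] by simp
    have slope: "((\<lambda>x. complex_of_real (mode_slope x)) has_vector_derivative of_real (k' x)) (at x)"
      unfolding k'_def by (intro has_vector_derivative_of_real mode_slope_deriv)
    have "((\<lambda>x. of_real x * u1 x + of_real (mode_slope x) * u0 x) has_vector_derivative
        u1 x + of_real x * u2 x + (of_real (k' x) * u0 x + of_real (mode_slope x) * u1 x)) (at x)"
      using has_vector_derivative_add[OF has_vector_derivative_mult[OF id u1[OF x]]
          has_vector_derivative_mult[OF slope u0[OF x]]] by (simp add: algebra_simps)
    note first = has_vector_derivative_mult[OF sq(2) this]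
    note second = has_vector_derivative_mult_right[OF has_vector_derivative_mult[OF sq(1) u0[OF x]], of \<nu>]
    show ?thesis
      using has_vector_derivative_diff[OF first second]
      unfolding y_def yd_def \<nu>_def[symmetric] by (simp add: algebra_simps)
  qed
  have yd_eq: "yd x = (P x - \<nu> * y x) / of_real (1 + x)" if "x \<in> {0<..<1}" for x
  proof -
    have "complex_of_real (1 + x) \<noteq> 0" using that by (simp only: of_real_eq_0_iff) simp
    then show ?thesis by (simp add: P_def)
  qed
  have second_eq: "of_real (1 - x) * P x
      = (\<nu> - of_real (superpotential x)) * y x + \<nu>\<^sup>2 * of_real x * u0 x" if x: "x \<in> {0<..<1}" for x
  proof -
    define X k d w V where "X = complex_of_real x" and "k = complex_of_real (mode_slope x)"
      and "d = complex_of_real (k' x)" and "w = complex_of_real (superpotential x)"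
      and "V = complex_of_real (potential f0 x)"
    have "X \<noteq> 0" using x by (simp add: X_def)
    have "superpotential x * x = (1 - x\<^sup>2) * (1 - mode_slope x)"
      using superpotential_mode_slope x by simp
    then have w: "w * X = (1 - X\<^sup>2) * (1 - k)"
      unfolding X_def k_def w_def by (metis of_real_1 of_real_diff of_real_mult of_real_power)
    have V: "V = (1 - X\<^sup>2) * (k\<^sup>2 - k - X * d) + 2 * X\<^sup>2 * k - 2 * X\<^sup>2"
      using arg_cong[OF mode_slope_riccati[of x], of complex_of_real]
      unfolding X_def k_def d_def V_def k'_def by simp
    have E: "- (1 - X\<^sup>2) * (X\<^sup>2 * u2 x + 2 * X * u1 x) + 2 * (\<nu> + 1) * X ^ 3 * u1 x
        + (\<nu> + 1) * (\<nu> + 2) * X\<^sup>2 * u0 x + V * u0 x = 0"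
      using ode[of x] x unfolding V_def[symmetric] X_def[symmetric] by (simp add: \<nu>_def algebra_simps)
    have y_eq: "y x = (1 - X\<^sup>2) * (X * u1 x + k * u0 x) - \<nu> * X\<^sup>2 * u0 x"
      unfolding y_def \<nu>_def[symmetric] by (simp add: X_def k_def)
    have yd_eq: "yd x = - 2 * X * (X * u1 x + k * u0 x)
        + (1 - X\<^sup>2) * (u1 x + X * u2 x + (d * u0 x + k * u1 x))
        - \<nu> * (2 * X * u0 x + X\<^sup>2 * u1 x)"
      unfolding yd_def by (simp add: X_def k_def d_def)
    \<comment> \<open>The only second derivative is inside \<open>yd\<close>, which fixes the multiple of the mode equation.\<close>
    have "X * ((1 - X) * (\<nu> * y x + (1 + X) * yd x)) - (\<nu> * X * y x - w * X * y x + \<nu>\<^sup>2 * X\<^sup>2 * u0 x)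
      = - (1 - X\<^sup>2) * (- (1 - X\<^sup>2) * (X\<^sup>2 * u2 x + 2 * X * u1 x) + 2 * (\<nu> + 1) * X ^ 3 * u1 x
        + (\<nu> + 1) * (\<nu> + 2) * X\<^sup>2 * u0 x + V * u0 x)"
      unfolding y_eq yd_eq w V by algebra
    then have "X * ((1 - X) * (\<nu> * y x + (1 + X) * yd x) - ((\<nu> - w) * y x + \<nu>\<^sup>2 * X * u0 x)) = 0"
      unfolding E by (simp add: algebra_simps power2_eq_square)
    then show ?thesis
      using \<open>X \<noteq> 0\<close> unfolding P_def by (simp add: X_def w_def)
  qed
  have "y 0 = 0"
    using ode[of 0] by (simp add: y_def potential_f0)
  moreover have "lam * P 1 + of_real (partner_potential 1) * y 1 = 0"
  proof -
    have vals: "potential f0 1 = - 3" "mode_slope 1 = - 1 / 2" "partner_potential 1 = 3"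
      by (simp_all add: potential_f0 mode_slope_def partner_potential_def)
    have y1: "y 1 = - \<nu> * u0 1" by (simp add: y_def \<nu>_def algebra_simps)
    have yd1: "yd 1 = - 2 * (u1 1 - u0 1 / 2) - \<nu> * (2 * u0 1 + u1 1)"
      by (simp add: yd_def vals)
    have "2 * lam * u1 1 + lam * (lam + 1) * u0 1 - 3 * u0 1 = 0"
      using ode[of 1] by (simp add: vals)
    then show ?thesis
      unfolding P_def yd1 y1 vals \<nu>_def by (simp add: field_simps) algebra
  qed
  moreover have "(P has_vector_derivative (lam * P x + of_real (partner_potential x) * y x) / of_real (1 - x)) (at x)"
    if x: "x \<in> {0<..<1}" for x
  proof -
    define X Q w w' k where "X = complex_of_real x" and "Q = complex_of_real (partner_potential x)"
      and "w = complex_of_real (superpotential x)" and "w' = complex_of_real (superpotential' x)"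
      and "k = complex_of_real (mode_slope x)"
    have "X \<noteq> 1" "X \<noteq> - 1" "x \<noteq> 0"
      using x unfolding X_def by (auto simp: complex_eq_iff)
    then have X: "1 - X\<^sup>2 \<noteq> 0"
      by (auto simp: power2_eq_1_iff)
    define g g' where "g = (\<lambda>x. (\<nu> - of_real (superpotential x)) * y x + \<nu>\<^sup>2 * of_real x * u0 x)"
      and "g' = (\<nu> - w) * yd x - w' * y x + \<nu>\<^sup>2 * (u0 x + X * u1 x)"
    have id: "((\<lambda>x. complex_of_real x) has_vector_derivative 1) (at x)"
      using has_vector_derivative_of_real[OF DERIV_ident, of "at x"] by simp
    have "((\<lambda>x. \<nu> - of_real (superpotential x)) has_vector_derivative 0 - w') (at x)"
      unfolding w'_def using superpotential_deriv[OF \<open>x \<noteq> 0\<close>]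
      by (intro has_vector_derivative_diff has_vector_derivative_const has_vector_derivative_of_real)
    note g1 = has_vector_derivative_mult[OF this y_deriv[OF x]]
    note g2 = has_vector_derivative_mult[OF has_vector_derivative_mult_right[OF id, of "\<nu>\<^sup>2"] u0[OF x]]
    have g_deriv: "(g has_vector_derivative g') (at x)"
      using has_vector_derivative_add[OF g1 g2]
      unfolding g_def g'_def w_def X_def by (simp add: algebra_simps)
    have "((\<lambda>x. inverse (1 - x)) has_real_derivative inverse ((1 - x)\<^sup>2)) (at x)"
      using x by (auto intro!: derivative_eq_intros simp: power2_eq_square)
    then have inv: "((\<lambda>x. complex_of_real (inverse (1 - x))) has_vector_derivative
        of_real (inverse ((1 - x)\<^sup>2))) (at x)"
      by (intro has_vector_derivative_of_real)
    have P_eq: "P z = of_real (inverse (1 - z)) * g z" if "z \<in> {0<..<1}" for z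
    proof -
      have "complex_of_real (1 - z) \<noteq> 0" using that by (simp only: of_real_eq_0_iff) simp
      then show ?thesis
        using second_eq[OF that] by (simp add: g_def field_simps)
    qed
    have "(P has_vector_derivative of_real (inverse (1 - x)) * g' + of_real (inverse ((1 - x)\<^sup>2)) * g x) (at x)"
      by (rule has_vector_derivative_transform_within_open[where S = "{0<..<1}", OF has_vector_derivative_mult[OF inv g_deriv]])
        (use x P_eq in auto)
    moreover have "of_real (inverse (1 - x)) * g' + of_real (inverse ((1 - x)\<^sup>2)) * g x
        = (g' + P x) / of_real (1 - x)"
      unfolding P_eq[OF x]
      by (simp only: power2_eq_square inverse_mult_distrib of_real_mult divide_inverse of_real_inverse
          distrib_left distrib_right mult_ac)
    moreover have "g' + P x = lam * P x + Q * y x"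
    proof -
      have "(1 - x\<^sup>2) * (1 - mode_slope x) = superpotential x * x"
        using superpotential_mode_slope[OF \<open>x \<noteq> 0\<close>] by simp
      then have slope: "(1 - X\<^sup>2) * (1 - k) = w * X"
        unfolding X_def k_def w_def by (metis of_real_1 of_real_diff of_real_mult of_real_power)
      have riccati: "(1 - X\<^sup>2) * Q = w\<^sup>2 - (1 - X\<^sup>2) * w'"
        using arg_cong[OF partner_potential_riccati[OF \<open>x \<noteq> 0\<close>], of complex_of_real]
        unfolding X_def Q_def w_def w'_def by simp
      have P: "(1 - X) * P x = (\<nu> - w) * y x + \<nu>\<^sup>2 * X * u0 x"
        using second_eq[OF x] by (simp add: X_def w_def)
      have yd: "(1 + X) * yd x = P x - \<nu> * y x"
        by (simp add: P_def X_def)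
      have "y x = (1 - X\<^sup>2) * (X * u1 x + k * u0 x) - \<nu> * X\<^sup>2 * u0 x"
        by (simp add: y_def X_def k_def \<nu>_def)
      then have u1_eq: "(1 - X\<^sup>2) * (u0 x + X * u1 x) = y x + (\<nu> * X + w) * X * u0 x"
        using slope by algebra
      define M where "M = (1 - X) * P x"
      have u0_eq: "\<nu>\<^sup>2 * X * u0 x = M - (\<nu> - w) * y x"
        unfolding M_def P by simp
      have "(1 - X\<^sup>2) * (g' + P x - (\<nu> + 1) * P x - Q * y x)
          = (\<nu> - w) * (1 - X) * ((1 + X) * yd x) - (1 - X\<^sup>2) * w' * y x
            + \<nu>\<^sup>2 * ((1 - X\<^sup>2) * (u0 x + X * u1 x)) - \<nu> * (1 + X) * M - (1 - X\<^sup>2) * Q * y x"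
        unfolding g'_def M_def by (simp add: algebra_simps power2_eq_square)
      also have "\<dots> = (\<nu> - w) * (M - (1 - X) * \<nu> * y x) + \<nu>\<^sup>2 * y x
            + (\<nu> * X + w) * (\<nu>\<^sup>2 * X * u0 x) - \<nu> * (1 + X) * M - w\<^sup>2 * y x"
        unfolding yd u1_eq riccati M_def by (simp add: algebra_simps power2_eq_square)
      also have "\<dots> = 0"
        unfolding u0_eq by (simp add: algebra_simps power2_eq_square)
      finally have "(1 - X\<^sup>2) * (g' + P x - (\<nu> + 1) * P x - Q * y x) = 0" .
      then have "g' + P x - (\<nu> + 1) * P x - Q * y x = 0"
        using X by simp
      then show ?thesis by (simp add: \<nu>_def algebra_simps)
    qed
    ultimately show ?thesis by (simp add: Q_def)
  qed
  ultimately show ?thesis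
    using that[of P] y_cont P_cont y_deriv yd_eq second_eq by (simp add: \<nu>_def)
qed

section \<open>Mode stability\<close>

lemma vanishes_on_closed_interval:
  fixes G :: "real \<Rightarrow> complex"
  assumes "continuous_on {0..1} G" "\<And>x. x \<in> {0<..<1} \<Longrightarrow> G x = 0" "x \<in> {0..1}"
  shows "G x = 0"
  using continuous_constant_on_closure[of "{0<..<1}" G 0 x] assms by simp

text \<open>Multiplied by \<open>x\<^sup>2\<close>, the mode equation has continuous coefficients on \<open>[0, 1]\<close>, so it extends to
  the end points, where it contains the regularity of \<open>u\<close> there.\<close>

lemma C_infinity_on_mode_equation:
  assumes smooth: "C_infinity_on {0..1} u" and ode: "\<forall>x\<in>{0<..<1}. mode_equation f lam u x"
    and V: "continuous_on {0..1} (potential f)"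
  obtains u0 u1 u2 :: "real \<Rightarrow> complex" where
    "\<And>x. x \<in> {0..1} \<Longrightarrow> u0 x = u x"
    "continuous_on {0..1} u0" "continuous_on {0..1} u1" "continuous_on {0..1} u2"
    "\<And>x. x \<in> {0<..<1} \<Longrightarrow> (u0 has_vector_derivative u1 x) (at x)"
    "\<And>x. x \<in> {0<..<1} \<Longrightarrow> (u1 has_vector_derivative u2 x) (at x)"
    "\<And>x. x \<in> {0..1} \<Longrightarrow> - (1 - of_real x ^ 2) * (of_real x ^ 2 * u2 x + 2 * of_real x * u1 x)
      + 2 * lam * of_real x ^ 3 * u1 x + lam * (lam + 1) * of_real x ^ 2 * u0 x
      + of_real (potential f x) * u0 x = 0"
proof -
  obtain D where D0: "\<And>x. x \<in> {0..1} \<Longrightarrow> D 0 x = u x"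
    and D: "\<And>n x. x \<in> {0..1} \<Longrightarrow> (D n has_vector_derivative D (Suc n) x) (at x within {0..1})"
    using smooth unfolding C_infinity_on_def by blast
  have D_at: "(D n has_vector_derivative D (Suc n) x) (at x)" if "x \<in> {0<..<1}" for n x
    using D[of x n] that by (simp add: at_within_Icc_at)
  have D_cont: "continuous_on {0..1} (D n)" for n
    unfolding continuous_on_eq_continuous_within using D has_vector_derivative_continuous by blast
  have first: "vector_derivative u (at x) = D 1 x" if "x \<in> {0<..<1}" for x
  proof (rule vector_derivative_at, rule has_vector_derivative_transform_within_open[where S = "{0<..<1}"])
    show "(D 0 has_vector_derivative D 1 x) (at x)" using D_at[OF that, of 0] by simp
  qed (use that D0 in auto)
  have second: "vector_derivative (\<lambda>x. vector_derivative u (at x)) (at x) = D 2 x" if "x \<in> {0<..<1}" for x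
  proof (rule vector_derivative_at, rule has_vector_derivative_transform_within_open[where S = "{0<..<1}"])
    show "(D 1 has_vector_derivative D 2 x) (at x)" using D_at[OF that, of 1] by (simp add: numeral_2_eq_2)
  qed (use that first in auto)
  define G where "G = (\<lambda>x. - (1 - of_real x ^ 2) * (of_real x ^ 2 * D 2 x + 2 * of_real x * D 1 x)
      + 2 * lam * of_real x ^ 3 * D 1 x + lam * (lam + 1) * of_real x ^ 2 * D 0 x
      + of_real (potential f x) * D 0 x)"
  have "G x = 0" if "x \<in> {0..1}" for x
  proof (rule vanishes_on_closed_interval[OF _ _ that])
    show "continuous_on {0..1} G"
      unfolding G_def using D_cont V by (intro continuous_intros) auto
    show "G x = 0" if x: "x \<in> {0<..<1}" for x
    proof -
      define X where "X = complex_of_real x"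
      have "X \<noteq> 0" using x by (simp add: X_def)
      have "- (1 - X\<^sup>2) * (D 2 x + 2 / X * D 1 x) + 2 * lam * X * D 1 x + lam * (lam + 1) * D 0 x
          + of_real (potential f x) / X\<^sup>2 * D 0 x = 0"
        using ode[rule_format, OF x] x
        unfolding mode_equation_def Let_def first[OF x] second[OF x]
        by (simp add: X_def D0)
      then have "X\<^sup>2 * (- (1 - X\<^sup>2) * (D 2 x + 2 / X * D 1 x) + 2 * lam * X * D 1 x + lam * (lam + 1) * D 0 x
          + of_real (potential f x) / X\<^sup>2 * D 0 x) = 0" by simp
      also have "X\<^sup>2 * (- (1 - X\<^sup>2) * (D 2 x + 2 / X * D 1 x) + 2 * lam * X * D 1 x + lam * (lam + 1) * D 0 x
          + of_real (potential f x) / X\<^sup>2 * D 0 x) = G x"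
        unfolding G_def X_def[symmetric] using \<open>X \<noteq> 0\<close>
        by (simp add: field_simps power2_eq_square power3_eq_cube)
      finally show ?thesis .
    qed
  qed
  then show ?thesis
    using that[of "D 0" "D 1" "D 2"] D0 D_cont D_at[of _ 0] D_at[of _ 1]
    unfolding G_def by (simp add: numeral_2_eq_2)
qed

text \<open>Both rigidity lemmas apply to the Darboux transform \<open>y\<close>, so \<open>y = 0\<close> and hence \<open>P = 0\<close>. The
  factorization identity then reads \<open>\<nu>\<^sup>2 x u = 0\<close>, which forces \<open>\<nu> = 0\<close>, and the definition of
  \<open>y\<close> becomes the first order equation satisfied by \<open>u\<^sub>1\<close>.\<close>

lemma unstable_mode_f0_unique:
  assumes "unstable_mode f0 lam u"
  shows "lam = 1 \<and> (\<exists>c. \<forall>x\<in>{0..1}. u x = c * complex_of_real (translation_mode f0 x))"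
proof -
  define \<nu> where "\<nu> = lam - 1"
  have lam: "Re lam \<ge> 0" and smooth: "C_infinity_on {0..1} u" and nonzero: "\<exists>x\<in>{0..1}. u x \<noteq> 0"
    and ode: "\<forall>x\<in>{0<..<1}. mode_equation f0 lam u x"
    using assms by (auto simp: unstable_mode_def)
  have "continuous_on {0..1} (potential f0)"
    unfolding potential_def[abs_def] using f0_derivatives(1)
    by (intro continuous_intros continuous_at_imp_continuous_on ballI) (blast intro: DERIV_isCont)+
  from C_infinity_on_mode_equation[OF smooth ode this]
  obtain u0 u1 u2 where
    u: "\<And>x. x \<in> {0..1} \<Longrightarrow> u0 x = u x" and
    cont: "continuous_on {0..1} u0" "continuous_on {0..1} u1" "continuous_on {0..1} u2" and
    u_derivs: "\<And>x. x \<in> {0<..<1} \<Longrightarrow> (u0 has_vector_derivative u1 x) (at x)"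
      "\<And>x. x \<in> {0<..<1} \<Longrightarrow> (u1 has_vector_derivative u2 x) (at x)" and
    cleared: "\<And>x. x \<in> {0..1} \<Longrightarrow> - (1 - of_real x ^ 2) * (of_real x ^ 2 * u2 x + 2 * of_real x * u1 x)
      + 2 * lam * of_real x ^ 3 * u1 x + lam * (lam + 1) * of_real x ^ 2 * u0 x
      + of_real (potential f0 x) * u0 x = 0"
    by blast
  define y where "y = (\<lambda>x. of_real (1 - x\<^sup>2) * (of_real x * u1 x + of_real (mode_slope x) * u0 x)
      - (lam - 1) * of_real (x\<^sup>2) * u0 x)"
  obtain P where
    y_cont: "continuous_on {0..1} y" and P_cont: "continuous_on {0..1} P" and left: "y 0 = 0" and
    right: "lam * P 1 + of_real (partner_potential 1) * y 1 = 0" and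
    y_deriv: "\<And>x. x \<in> {0<..<1} \<Longrightarrow>
      (y has_vector_derivative (P x - (lam - 1) * y x) / of_real (1 + x)) (at x)" and
    P_deriv: "\<And>x. x \<in> {0<..<1} \<Longrightarrow>
      (P has_vector_derivative (lam * P x + of_real (partner_potential x) * y x) / of_real (1 - x)) (at x)" and
    P_eq: "\<And>x. x \<in> {0<..<1} \<Longrightarrow> of_real (1 - x) * P x
      = (lam - 1 - of_real (superpotential x)) * y x + (lam - 1)\<^sup>2 * of_real x * u0 x"
    using darboux_half_wave_system[OF cont u_derivs cleared] unfolding y_def by blast
  have Q_pos: "partner_potential x > 1 / 4" if "x \<in> {0<..1}" for x
    using partner_potential_lower_bound[OF that] .
  have y_zero: "y x = 0" if x: "x \<in> {0<..<1}" for x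
  proof (cases "Im lam = 0")
    case True
    define l where "l = Re lam"
    have lam_real: "lam = of_real l" using True by (simp add: l_def complex_eq_iff)
    have "l * (l - 1) + partner_potential x > 0" if "x \<in> {0<..1}" for x
    proof -
      have "l * (l - 1) = (l - 1 / 2)\<^sup>2 - 1 / 4" by (simp add: power2_eq_square algebra_simps)
      then show ?thesis using Q_pos[OF that] zero_le_power2[of "l - 1 / 2"] by linarith
    qed
    then show ?thesis
      using real_half_wave_rigidity[of l y P partner_potential x] lam l_def y_cont P_cont left right y_deriv P_deriv x
      unfolding lam_real by simp
  next
    case False
    obtain m' where m': "\<And>x. x \<in> {0<..<1} \<Longrightarrow> m' x > 0 \<and> (partner_weight has_real_derivative m' x) (at x)"
      using partner_weight_increasing by metis
    have weight_cont: "continuous_on {0..1} partner_weight"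
    proof -
      have "1 + x \<noteq> 0" "6 * (50 - 15 * x\<^sup>2 - 3 * x ^ 6) \<noteq> 0" if "x \<in> {0..1}" for x :: real
        using that partner_numerator_ge[OF that] by auto
      then show ?thesis
        unfolding partner_weight_def[abs_def] by (intro continuous_intros) auto
    qed
    have weight_pos: "partner_weight x > 0" if "x \<in> {0<..<1}" for x
      using that partner_numerator_ge[of x] denominator_pos[of x]
      unfolding partner_weight_def by (intro mult_pos_pos divide_pos_pos zero_less_power) auto
    show ?thesis
      by (rule nonreal_half_wave_rigidity[OF lam False y_cont P_cont weight_cont y_deriv P_deriv
            m'[THEN conjunct2] weight_pos m'[THEN conjunct1] partner_weight_potential left _ right _ x])
        (use Q_pos[of 1] in \<open>simp_all add: partner_weight_def\<close>)
  qed
  have P_zero: "P x = 0" if x: "x \<in> {0<..<1}" for x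
  proof -
    have "(y has_vector_derivative 0) (at x)"
      by (rule has_vector_derivative_transform_within_open[where f = "\<lambda>_. 0" and S = "{0<..<1}"])
        (use x y_zero in auto)
    then have "(P x - (lam - 1) * y x) / of_real (1 + x) = 0"
      using y_deriv[OF x] vector_derivative_unique_at by blast
    moreover have "complex_of_real (1 + x) \<noteq> 0" using x by (simp only: of_real_eq_0_iff) simp
    ultimately show ?thesis using y_zero[OF x] by simp
  qed
  have "\<nu> = 0"
  proof (rule ccontr)
    assume "\<nu> \<noteq> 0"
    then have "u0 x = 0" if "x \<in> {0<..<1}" for x
      using P_eq[OF that] P_zero[OF that] y_zero[OF that] that by (simp add: \<nu>_def)
    then have "u0 x = 0" if "x \<in> {0..1}" for x
      using vanishes_on_closed_interval[OF cont(1) _ that] by blast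
    then show False using nonzero u by auto
  qed
  then have lam1: "lam = 1" by (simp add: \<nu>_def)
  have u1_eq: "of_real x * u1 x = - of_real (mode_slope x) * u0 x" if x: "x \<in> {0<..<1}" for x
  proof -
    have "x\<^sup>2 \<noteq> 1" using x by (simp add: power2_eq_1_iff)
    then have "complex_of_real (1 - x\<^sup>2) \<noteq> 0" by (simp only: of_real_eq_0_iff)
    then show ?thesis
      using y_zero[OF x] lam1 by (simp add: y_def eq_neg_iff_add_eq_0)
  qed
  \<comment> \<open>The quotient \<open>u / u\<^sub>1\<close>, which the first order equation makes constant.\<close>
  define r where "r = (\<lambda>x. complex_of_real ((5 + 3 * x\<^sup>2)\<^sup>2 / (80 * x\<^sup>2)) * u0 x)"
  have "(r has_vector_derivative 0) (at x)" if x: "x \<in> {0<..<1}" for x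
  proof -
    have "((\<lambda>x. (5 + 3 * x\<^sup>2)\<^sup>2 / (80 * x\<^sup>2)) has_real_derivative
        (5 + 3 * x\<^sup>2)\<^sup>2 / (80 * x\<^sup>2) * mode_slope x / x) (at x)"
      using x denominator_pos[of x]
      by (auto intro!: derivative_eq_intros simp: mode_slope_def divide_simps power2_eq_square)
        (simp add: algebra_simps)
    then have "((\<lambda>x. complex_of_real ((5 + 3 * x\<^sup>2)\<^sup>2 / (80 * x\<^sup>2))) has_vector_derivative
        of_real ((5 + 3 * x\<^sup>2)\<^sup>2 / (80 * x\<^sup>2) * mode_slope x / x)) (at x)"
      by (rule has_vector_derivative_of_real)
    note r_deriv = has_vector_derivative_mult[OF this u_derivs(1)[OF x]]
    have "u1 x = - of_real (mode_slope x / x) * u0 x"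
      using u1_eq[OF x] x by (simp add: field_simps)
    then have "of_real ((5 + 3 * x\<^sup>2)\<^sup>2 / (80 * x\<^sup>2)) * u1 x
      + of_real ((5 + 3 * x\<^sup>2)\<^sup>2 / (80 * x\<^sup>2) * mode_slope x / x) * u0 x = 0"
      by simp
    with r_deriv show ?thesis unfolding r_def by simp
  qed
  then have "(r has_vector_derivative 0) (at x within {0<..<1})" if "x \<in> {0<..<1}" for x
    using has_vector_derivative_at_within that by blast
  then obtain c where c: "\<And>x. x \<in> {0<..<1} \<Longrightarrow> r x = c"
    using has_vector_derivative_zero_constant[of "{0<..<1}" r] by (metis convex_real_interval(8))
  have "u0 x - c * complex_of_real (translation_mode f0 x) = 0" if "x \<in> {0..1}" for x
  proof (rule vanishes_on_closed_interval[OF _ _ that])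
    have "5 + 3 * x\<^sup>2 \<noteq> 0" for x :: real using denominator_pos[of x] by simp
    then show "continuous_on {0..1} (\<lambda>x. u0 x - c * complex_of_real (translation_mode f0 x))"
      unfolding translation_mode_f0 using cont(1) by (intro continuous_intros) auto
    show "u0 x - c * complex_of_real (translation_mode f0 x) = 0" if x: "x \<in> {0<..<1}" for x
    proof -
      have "(5 + 3 * x\<^sup>2)\<^sup>2 / (80 * x\<^sup>2) * (80 * x\<^sup>2 / (5 + 3 * x\<^sup>2)\<^sup>2) = 1"
        using x denominator_pos[of x] by simp
      then have "complex_of_real ((5 + 3 * x\<^sup>2)\<^sup>2 / (80 * x\<^sup>2)) * of_real (translation_mode f0 x) = 1"
        unfolding translation_mode_f0 by (simp only: of_real_mult[symmetric] of_real_1)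
      then show ?thesis
        using c[OF x] unfolding r_def by algebra
    qed
  qed
  then show ?thesis using lam1 u by auto
qed

theorem theorem1p2:
  shows "yang_mills_solution (self_similar f0) \<and>
    (\<forall>\<rho>. potential f0 \<rho> = 6 * ((25 - 90 * \<rho>\<^sup>2 + 33 * \<rho>^4) / (5 + 3 * \<rho>\<^sup>2)\<^sup>2)) \<and>
    (\<forall>\<rho>. translation_mode f0 \<rho> = 80 * \<rho>\<^sup>2 / (5 + 3 * \<rho>\<^sup>2)\<^sup>2) \<and>
    mode_stable f0"
  using yang_mills_solution_f0 potential_f0 translation_mode_f0
    unstable_mode_translation_mode unstable_mode_f0_unique
  by (simp add: mode_stable_def)

end
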